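(* Let $0\le w_1\le w_2\le\dots$, $w=\{w_k\}_{k\ge1}$, and define $\gamma=\{\gamma_k\}_{k\ge1}$ by $\gamma_1=w_1$, $\gamma_k=w_k-w_{k-1}$ ($k\ge2$). Let $F\in H^2$, let $\theta$ be an inner function, and let $\{g_n\}$ be an orthonormal basis of $K_\theta$ (possibly finite). Put $\Phi:=zT_{\overline z\overline\theta}F$ and $h_n:=zT_{\overline\theta}(Fg_n)$. Then $$\|F\|_w^2=\|\Phi\|_w^2+\sum_n\|h_n\|_\gamma^2,$$ as an identity in $[0,\infty]$.
   Context: $\mathbb T$ is the unit circle with normalized arclength $m$; $H^p$ is the Hardy space identified with boundary functions; $\widehat F(n)=\int_{\mathbb T}F\overline\zeta^n dm$. $P_+F=\sum_{n\ge0}\widehat F(n)z^n$ (for $F\in L^1$ understood as the formal series/analytic function with these coefficients), and $T_\psi f=P_+(\psi f)$ (Toeplitz operator) whenever $\psi f\in L^1$. An inner function is $\theta\in H^\infty$ with $|\theta|=1$ a.e. on $\mathbb T$; $K_\theta=H^2\ominus\theta H^2$. For a sequence $v=\{v_k\}_{k\ge1}$ of nonnegative numbers and an analytic $h$ with Taylor coefficients $\widehat h(k)$, $\|h\|_v:=\big(\sum_{k\ge1}v_k|\widehat h(k)|^2\big)^{1/2}\in[0,\infty]$. *)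

theory Defs
  imports "HOL-Analysis.Analysis"
begin

text \<open>Functions on the unit circle T are functions complex => complex, evaluated at cis t,
  t in [0, 2 pi]; normalized arclength m corresponds to (1/(2 pi)) dt.\<close>

definition circ_int :: "(complex \<Rightarrow> complex) \<Rightarrow> complex" where
  "circ_int f = (LINT t:{0..2*pi}|lborel. f (cis t)) / complex_of_real (2*pi)"

definition fourier :: "(complex \<Rightarrow> complex) \<Rightarrow> int \<Rightarrow> complex" where
  "fourier F n = circ_int (\<lambda>z. F z * cnj z powi n)"

definition in_L2 :: "(complex \<Rightarrow> complex) \<Rightarrow> bool" where
  "in_L2 F \<longleftrightarrow> set_borel_measurable lborel {0..2*pi} (\<lambda>t. F (cis t)) \<and>
     set_integrable lborel {0..2*pi} (\<lambda>t. (cmod (F (cis t)))^2)"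

definition H2 :: "(complex \<Rightarrow> complex) \<Rightarrow> bool" where
  "H2 F \<longleftrightarrow> in_L2 F \<and> (\<forall>n::int. n < 0 \<longrightarrow> fourier F n = 0)"

definition Hinf :: "(complex \<Rightarrow> complex) \<Rightarrow> bool" where
  "Hinf F \<longleftrightarrow> set_borel_measurable lborel {0..2*pi} (\<lambda>t. F (cis t)) \<and>
     (\<exists>C. AE t in lborel. t \<in> {0..2*pi} \<longrightarrow> cmod (F (cis t)) \<le> C) \<and>
     (\<forall>n::int. n < 0 \<longrightarrow> fourier F n = 0)"

definition inner_fun :: "(complex \<Rightarrow> complex) \<Rightarrow> bool" where
  "inner_fun \<theta> \<longleftrightarrow> Hinf \<theta> \<and> (AE t in lborel. t \<in> {0..2*pi} \<longrightarrow> cmod (\<theta> (cis t)) = 1)"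

definition ip :: "(complex \<Rightarrow> complex) \<Rightarrow> (complex \<Rightarrow> complex) \<Rightarrow> complex" where
  "ip f g = circ_int (\<lambda>z. f z * cnj (g z))"

definition model_space :: "(complex \<Rightarrow> complex) \<Rightarrow> (complex \<Rightarrow> complex) set" where
  "model_space \<theta> = {f. H2 f \<and> (\<forall>g. H2 g \<longrightarrow> ip f (\<lambda>z. \<theta> z * g z) = 0)}"

definition is_onb :: "(complex \<Rightarrow> complex) set \<Rightarrow> nat set \<Rightarrow> (nat \<Rightarrow> complex \<Rightarrow> complex) \<Rightarrow> bool" where
  "is_onb K I g \<longleftrightarrow> (\<forall>n\<in>I. g n \<in> K) \<and>
     (\<forall>n\<in>I. \<forall>m\<in>I. ip (g n) (g m) = (if n = m then 1 else 0)) \<and>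
     (\<forall>f\<in>K. (\<forall>n\<in>I. ip f (g n) = 0) \<longrightarrow> (AE t in lborel. t \<in> {0..2*pi} \<longrightarrow> f (cis t) = 0))"

text \<open>P_+ F as the formal power series (Taylor coefficient sequence).\<close>
definition Pplus :: "(complex \<Rightarrow> complex) \<Rightarrow> nat \<Rightarrow> complex" where
  "Pplus F k = fourier F (int k)"

definition toeplitz :: "(complex \<Rightarrow> complex) \<Rightarrow> (complex \<Rightarrow> complex) \<Rightarrow> nat \<Rightarrow> complex" where
  "toeplitz \<psi> f = Pplus (\<lambda>z. \<psi> z * f z)"

definition mul_z :: "(nat \<Rightarrow> complex) \<Rightarrow> nat \<Rightarrow> complex" where
  "mul_z c k = (case k of 0 \<Rightarrow> 0 | Suc j \<Rightarrow> c j)"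

definition wnorm_sq :: "(nat \<Rightarrow> real) \<Rightarrow> (nat \<Rightarrow> complex) \<Rightarrow> ennreal" where
  "wnorm_sq v c = (\<Sum>k. ennreal (v (Suc k) * (cmod (c (Suc k)))^2))"

end

theory Submission
  imports Defs
begin

text \<open>Summation by parts (\<open>w\<^sub>k = \<gamma>\<^sub>1 + \<dots> + \<gamma>\<^sub>k\<close>) reduces the identity to one for each tail: with \<open>G\<close> the
  projection of \<open>z\<^sup>-\<^sup>j F\<close> to \<open>H\<^sup>2\<close>, the tail \<open>\<Sum>\<^sub>k\<^sub>\<ge>\<^sub>j |F\<^sub>k|\<^sup>2\<close> is \<open>\<parallel>G\<parallel>\<^sup>2\<close>. The conjugation \<open>f \<mapsto> \<theta> cnj (z f)\<close> maps the
  model space antiunitarily onto itself, so the \<open>\<theta> z\<^sup>m\<close> together with the conjugates of the \<open>g\<^sub>n\<close> form an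
  orthonormal basis of \<open>H\<^sup>2\<close>. The coefficients of \<open>G\<close> in this basis are exactly the Taylor coefficients
  \<open>\<Phi>\<^sub>m\<^sub>+\<^sub>j\<close> and the \<open>j\<close>-th coefficients of the \<open>h\<^sub>n\<close>, and Parseval's identity gives the claim.\<close>

section \<open>Square-integrable functions and Parseval\<close>

text \<open>The obstacle is that \<open>F * g n\<close> is merely integrable, so \<open>h n\<close>
  is only a coefficient sequence, and \<open>g n\<close> enters it without the conjugate that an
  inner product would put there. The conjugation cures both: on the circle,
  \<open>F * g n * cnj \<theta> * cnj z ^ j\<close> is \<open>F\<close> times the conjugate of
  \<open>z ^ (j + 1) * \<theta> * cnj (z * g n)\<close>, so every coefficient of \<open>h n\<close>
  is an inner product of two L2 functions. Completeness of the combined basis uses that the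
  conjugation exchanges two conditions: orthogonality of f to all \<open>\<theta> * z ^ m\<close>
  makes its conjugate analytic, and analyticity of f makes its conjugate orthogonal to \<theta> H2.
  A function in H2 orthogonal to the whole system thus has its conjugate in the model space and
  orthogonal to every \<open>g n\<close>, so it vanishes almost everywhere. Parseval rests on
  completeness of L2 (for finite measures) and on uniqueness of Fourier coefficients on the circle.
  Monotonicity of w makes the increments \<open>\<gamma>\<close> nonnegative, so all sums take
  values in [0, \<infinity>] and may be exchanged without convergence conditions.\<close>

definition sq_integrable :: "'a measure \<Rightarrow> ('a \<Rightarrow> complex) \<Rightarrow> bool" where
  "sq_integrable M f \<longleftrightarrow> f \<in> borel_measurable M \<and> integrable M (\<lambda>x. (cmod (f x))\<^sup>2)"

definition l2_inner :: "'a measure \<Rightarrow> ('a \<Rightarrow> complex) \<Rightarrow> ('a \<Rightarrow> complex) \<Rightarrow> complex" where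
  "l2_inner M f g = (\<integral>x. f x * cnj (g x) \<partial>M)"

definition l2_sq :: "'a measure \<Rightarrow> ('a \<Rightarrow> complex) \<Rightarrow> real" where
  "l2_sq M f = (\<integral>x. (cmod (f x))\<^sup>2 \<partial>M)"

lemma sq_integrable_measurable: "sq_integrable M f \<Longrightarrow> f \<in> borel_measurable M"
  by (simp add: sq_integrable_def)

lemma sq_integrable_bound:
  assumes "integrable M h" "f \<in> borel_measurable M" "AE x in M. (cmod (f x))\<^sup>2 \<le> h x"
  shows "sq_integrable M f"
  unfolding sq_integrable_def
proof
  show "integrable M (\<lambda>x. (cmod (f x))\<^sup>2)"
  proof (rule Bochner_Integration.integrable_bound[OF assms(1)])
    show "AE x in M. norm ((cmod (f x))\<^sup>2) \<le> norm (h x)"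
      using assms(3) by eventually_elim simp
    show "(\<lambda>x. (cmod (f x))\<^sup>2) \<in> borel_measurable M" using assms(2) by simp
  qed
qed (rule assms(2))

lemma norm_add_sq_le: "(cmod (a + b))\<^sup>2 \<le> 2 * (cmod a)\<^sup>2 + 2 * (cmod b)\<^sup>2"
proof -
  have "(cmod (a + b))\<^sup>2 \<le> (cmod a + cmod b)\<^sup>2" by (simp add: norm_triangle_ineq power_mono)
  also have "\<dots> \<le> 2 * (cmod a)\<^sup>2 + 2 * (cmod b)\<^sup>2" using zero_le_power2[of "cmod a - cmod b"] by (simp add: power2_eq_square algebra_simps)
  finally show ?thesis .
qed

lemma sq_integrable_add:
  assumes "sq_integrable M f" "sq_integrable M g"
  shows "sq_integrable M (\<lambda>x. f x + g x)"
proof (rule sq_integrable_bound)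
  show "integrable M (\<lambda>x. 2 * (cmod (f x))\<^sup>2 + 2 * (cmod (g x))\<^sup>2)"
    using assms by (simp add: sq_integrable_def)
qed (use assms in \<open>auto simp: sq_integrable_def norm_add_sq_le\<close>)

lemma sq_integrable_mult_bounded:
  assumes "sq_integrable M f" "b \<in> borel_measurable M" "AE x in M. cmod (b x) \<le> C"
  shows "sq_integrable M (\<lambda>x. b x * f x)"
proof (rule sq_integrable_bound)
  show "integrable M (\<lambda>x. C\<^sup>2 * (cmod (f x))\<^sup>2)"
    using assms by (simp add: sq_integrable_def)
  show "AE x in M. (cmod (b x * f x))\<^sup>2 \<le> C\<^sup>2 * (cmod (f x))\<^sup>2"
    using assms(3) by eventually_elim (auto simp: norm_mult power_mult_distrib intro!: mult_right_mono power_mono)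
qed (use assms in \<open>auto simp: sq_integrable_def\<close>)

lemma sq_integrable_cmult: "sq_integrable M f \<Longrightarrow> sq_integrable M (\<lambda>x. c * f x)"
  by (rule sq_integrable_mult_bounded[where C = "cmod c"]) auto

lemma borel_measurable_cnj [measurable (raw)]:
  "f \<in> borel_measurable M \<Longrightarrow> (\<lambda>x. cnj (f x)) \<in> borel_measurable M"
  by (rule measurable_compose[OF _ borel_measurable_continuous_onI]) (auto intro: continuous_intros)

lemma sq_integrable_cnj: "sq_integrable M f \<Longrightarrow> sq_integrable M (\<lambda>x. cnj (f x))"
  by (auto simp: sq_integrable_def)

lemma sq_integrable_diff:
  assumes "sq_integrable M f" "sq_integrable M g"
  shows "sq_integrable M (\<lambda>x. f x - g x)"
  using sq_integrable_add[OF assms(1) sq_integrable_cmult[OF assms(2), of "-1"]] by simp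

lemma sq_integrable_sum:
  assumes "\<And>i. i \<in> A \<Longrightarrow> sq_integrable M (f i)"
  shows "sq_integrable M (\<lambda>x. \<Sum>i\<in>A. f i x)"
proof (cases "finite A")
  case True
  then show ?thesis using assms
    by (induction A) (auto simp: sq_integrable_add, simp add: sq_integrable_def)
qed (simp add: sq_integrable_def)

text \<open>Expand the square of \<open>t * cmod a - cmod b\<close> and divide by
  \<open>2 * t\<close>. The free weight stands in for Cauchy-Schwarz: \<open>t = 1\<close> gives
  integrability of products, \<open>t = 2 ^ k\<close> balances the Riesz-Fischer estimate, and a
  \<open>t\<close> tuned to the target accuracy gives continuity of the inner product.\<close>

lemma norm_mult_le_weighted:
  fixes t :: real
  assumes "0 < t"
  shows "cmod (a * b) \<le> t / 2 * (cmod a)\<^sup>2 + (cmod b)\<^sup>2 / (2 * t)"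
proof -
  have "0 \<le> (t * cmod a - cmod b)\<^sup>2 / (2 * t)" using assms by simp
  also have "\<dots> = t / 2 * (cmod a)\<^sup>2 + (cmod b)\<^sup>2 / (2 * t) - cmod (a * b)"
    using assms by (simp add: norm_mult power2_eq_square field_simps)
  finally show ?thesis by simp
qed

lemma integrable_mult_sq:
  assumes "sq_integrable M f" "sq_integrable M g"
  shows "integrable M (\<lambda>x. f x * g x)"
proof (rule Bochner_Integration.integrable_bound)
  show "integrable M (\<lambda>x. 1 / 2 * (cmod (f x))\<^sup>2 + (cmod (g x))\<^sup>2 / (2 * 1))"
    using assms by (simp add: sq_integrable_def)
  have "cmod (f x * g x) \<le> norm (1 / 2 * (cmod (f x))\<^sup>2 + (cmod (g x))\<^sup>2 / (2 * 1))" for x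
    using norm_mult_le_weighted[of 1 "f x" "g x"] by simp
  then show "AE x in M. norm (f x * g x) \<le> norm (1 / 2 * (cmod (f x))\<^sup>2 + (cmod (g x))\<^sup>2 / (2 * 1))"
    by blast
qed (use assms in \<open>auto simp: sq_integrable_def\<close>)

lemma integrable_l2_inner:
  "sq_integrable M f \<Longrightarrow> sq_integrable M g \<Longrightarrow> integrable M (\<lambda>x. f x * cnj (g x))"
  by (simp add: integrable_mult_sq sq_integrable_cnj)

lemma (in finite_measure) integrable_sq_integrable:
  "sq_integrable M f \<Longrightarrow> integrable M f"
  using integrable_mult_sq[of M f "\<lambda>_. 1"] by (simp add: sq_integrable_def)

lemma l2_inner_diff_left:
  "sq_integrable M f \<Longrightarrow> sq_integrable M g \<Longrightarrow> sq_integrable M h \<Longrightarrow>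
    l2_inner M (\<lambda>x. f x - g x) h = l2_inner M f h - l2_inner M g h"
  by (simp add: l2_inner_def left_diff_distrib integrable_l2_inner)

lemma l2_inner_cmult_left: "l2_inner M (\<lambda>x. c * f x) g = c * l2_inner M f g"
  by (simp add: l2_inner_def mult.assoc)

lemma l2_inner_commute: "l2_inner M g f = cnj (l2_inner M f g)"
  unfolding l2_inner_def by (simp add: mult.commute flip: Bochner_Integration.integral_cnj)

lemma l2_inner_sum_left:
  assumes "\<And>i. i \<in> A \<Longrightarrow> sq_integrable M (f i)" "sq_integrable M g"
  shows "l2_inner M (\<lambda>x. \<Sum>i\<in>A. f i x) g = (\<Sum>i\<in>A. l2_inner M (f i) g)"
  using assms by (simp add: l2_inner_def sum_distrib_right integrable_l2_inner)

lemma l2_inner_self: "l2_inner M f f = of_real (l2_sq M f)"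
  by (simp add: l2_inner_def l2_sq_def complex_norm_square[symmetric] flip: integral_complex_of_real)

lemma l2_sq_nonneg: "0 \<le> l2_sq M f"
  by (simp add: l2_sq_def)

lemma l2_sq_commute_diff: "l2_sq M (\<lambda>x. f x - g x) = l2_sq M (\<lambda>x. g x - f x)"
  by (simp add: l2_sq_def norm_minus_commute)

lemma l2_inner_weighted_bound:
  assumes "sq_integrable M f" "sq_integrable M g" "0 < t"
  shows "cmod (l2_inner M f g) \<le> t / 2 * l2_sq M f + l2_sq M g / (2 * t)"
proof -
  have "cmod (l2_inner M f g) \<le> (\<integral>x. t / 2 * (cmod (f x))\<^sup>2 + (cmod (g x))\<^sup>2 / (2 * t) \<partial>M)"
    unfolding l2_inner_def
  proof (rule order_trans[OF integral_norm_bound integral_mono])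
    show "integrable M (\<lambda>x. norm (f x * cnj (g x)))"
      using integrable_l2_inner[OF assms(1,2)] by (rule integrable_norm)
    show "norm (f x * cnj (g x)) \<le> t / 2 * (cmod (f x))\<^sup>2 + (cmod (g x))\<^sup>2 / (2 * t)" for x
      using norm_mult_le_weighted[OF assms(3), of "f x" "cnj (g x)"] by simp
  qed (use assms in \<open>auto simp: sq_integrable_def integrable_l2_inner\<close>)
  also have "\<dots> = t / 2 * l2_sq M f + l2_sq M g / (2 * t)"
    using assms by (simp add: l2_sq_def sq_integrable_def)
  finally show ?thesis .
qed

lemma l2_inner_tendsto:
  assumes "\<And>n. sq_integrable M (s n)" "sq_integrable M f" "sq_integrable M g"
    and lim: "(\<lambda>n. l2_sq M (\<lambda>x. s n x - f x)) \<longlonglongrightarrow> 0"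
  shows "(\<lambda>n. l2_inner M (s n) g) \<longlonglongrightarrow> l2_inner M f g"
proof (rule LIMSEQ_I)
  fix r :: real assume r: "0 < r"
  \<comment> \<open>This weight pushes the term with the fixed norm of \<open>g\<close> below
    \<open>r / 2\<close>; the other term is then made small by taking n large. The summand 1 keeps
    \<open>t\<close> positive when \<open>g\<close> vanishes.\<close>
  define t where "t = (l2_sq M g + 1) / r"
  have t: "0 < t" using r l2_sq_nonneg[of M g] by (simp add: t_def add_nonneg_pos)
  have gt: "l2_sq M g / (2 * t) < r / 2"
    using r l2_sq_nonneg[of M g] by (simp add: t_def field_simps)
  obtain N where N: "\<And>n. n \<ge> N \<Longrightarrow> l2_sq M (\<lambda>x. s n x - f x) < r / t"
    using LIMSEQ_D[OF lim, of "r / t"] r t by (auto simp: abs_of_nonneg[OF l2_sq_nonneg])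
  show "\<exists>no. \<forall>n\<ge>no. norm (l2_inner M (s n) g - l2_inner M f g) < r"
  proof (intro exI allI impI)
    fix n assume "n \<ge> N"
    then have "t / 2 * l2_sq M (\<lambda>x. s n x - f x) < r / 2"
      using N[of n] t by (simp add: field_simps)
    moreover have "cmod (l2_inner M (s n) g - l2_inner M f g)
        \<le> t / 2 * l2_sq M (\<lambda>x. s n x - f x) + l2_sq M g / (2 * t)"
      using l2_inner_weighted_bound[OF sq_integrable_diff[OF assms(1,2)] assms(3) t, of n] assms
      by (simp add: l2_inner_diff_left)
    ultimately show "norm (l2_inner M (s n) g - l2_inner M f g) < r" using gt by simp
  qed
qed

section \<open>Completeness of L2 over a finite measure\<close>

lemma nn_integral_sq:
  "sq_integrable M f \<Longrightarrow> (\<integral>\<^sup>+x. ennreal ((cmod (f x))\<^sup>2) \<partial>M) = ennreal (l2_sq M f)"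
  by (simp add: sq_integrable_def l2_sq_def nn_integral_eq_integral)

text \<open>Pass to a subsequence whose increments have geometrically small L2 norm. On a finite
  measure their L1 norms are then summable, so the increments are absolutely summable almost
  everywhere and the subsequence has a pointwise limit. Fatou's lemma turns the Cauchy estimate into
  an estimate of the distance to that limit, for the whole sequence.\<close>

theorem (in finite_measure) riesz_fischer:
  fixes s :: "nat \<Rightarrow> 'a \<Rightarrow> complex"
  assumes s: "\<And>n. sq_integrable M (s n)"
    and cauchy: "\<And>e. 0 < e \<Longrightarrow> \<exists>N. \<forall>m\<ge>N. \<forall>n\<ge>N. l2_sq M (\<lambda>x. s m x - s n x) < e"
  obtains f where "sq_integrable M f" "(\<lambda>n. l2_sq M (\<lambda>x. s n x - f x)) \<longlonglongrightarrow> 0"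
proof -
  have [measurable]: "s n \<in> borel_measurable M" for n using s by (simp add: sq_integrable_def)
  have "\<forall>k. \<exists>N. \<forall>m\<ge>N. \<forall>n\<ge>N. l2_sq M (\<lambda>x. s m x - s n x) < (1 / 4) ^ k"
    using cauchy by simp
  then obtain R where R: "\<And>k m n. m \<ge> R k \<Longrightarrow> n \<ge> R k \<Longrightarrow> l2_sq M (\<lambda>x. s m x - s n x) < (1 / 4) ^ k"
    by metis
  \<comment> \<open>Summing the thresholds makes \<open>r\<close> increasing and at least
    \<open>R k\<close>; the added \<open>k\<close> makes it tend to infinity.\<close>
  define r where "r k = (\<Sum>i\<le>k. R i) + k" for k
  have r_ge: "r k \<ge> R k" for k
    by (simp add: r_def member_le_sum trans_le_add1)
  have r_Suc: "r (Suc k) \<ge> r k" for k by (simp add: r_def)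
  have r_id: "r k \<ge> k" for k by (simp add: r_def)
  define d where "d k x = s (r (Suc k)) x - s (r k) x" for k x
  have [measurable]: "d k \<in> borel_measurable M" for k unfolding d_def[abs_def] by simp
  have d_sq: "sq_integrable M (d k)" for k unfolding d_def[abs_def] by (rule sq_integrable_diff[OF s s])
  have d_small: "l2_sq M (d k) \<le> (1 / 4) ^ k" for k
    unfolding d_def[abs_def] using R[of k "r (Suc k)" "r k"] r_ge[of k] r_Suc[of k] by simp
  define m where "m = measure M (space M)"
  have d_int: "(\<integral>\<^sup>+x. ennreal (cmod (d k x)) \<partial>M) \<le> ennreal ((1 + m) * (1 / 2) ^ k)" for k
  proof -
    have "(\<integral>\<^sup>+x. ennreal (cmod (d k x)) \<partial>M) = ennreal (\<integral>x. cmod (d k x) \<partial>M)"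
      using integrable_sq_integrable[OF d_sq] by (intro nn_integral_eq_integral) auto
    \<comment> \<open>With weight \<open>2 ^ k\<close> both terms decay like
      \<open>(1 / 2) ^ k\<close>: the first because \<open>l2_sq M (d k)\<close> is at most
      \<open>(1 / 4) ^ k\<close>, the second because the weight divides the total mass.\<close>
    also have "(\<integral>x. cmod (d k x) \<partial>M) \<le> (\<integral>x. 2 ^ k / 2 * (cmod (d k x))\<^sup>2 + 1 / (2 * 2 ^ k) \<partial>M)"
    proof (rule integral_mono)
      show "cmod (d k x) \<le> 2 ^ k / 2 * (cmod (d k x))\<^sup>2 + 1 / (2 * 2 ^ k)" for x
        using norm_mult_le_weighted[of "2 ^ k" "d k x" 1] by simp
      show "integrable M (\<lambda>x. cmod (d k x))" using integrable_sq_integrable[OF d_sq] by simp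
    qed (use d_sq in \<open>simp add: sq_integrable_def\<close>)
    also have "\<dots> = 2 ^ k / 2 * l2_sq M (d k) + m / (2 * 2 ^ k)"
      using d_sq by (simp add: sq_integrable_def l2_sq_def m_def)
    also have "\<dots> \<le> 2 ^ k / 2 * (1 / 4) ^ k + m / (2 * 2 ^ k)"
      using d_small[of k] by (intro add_right_mono mult_left_mono) auto
    also have "\<dots> = (1 + m) * (1 / 2) ^ k / 2"
    proof -
      have "(4::real) ^ k = 2 ^ k * 2 ^ k" by (simp flip: power_mult_distrib)
      then show ?thesis by (simp add: field_simps power_divide)
    qed
    also have "\<dots> \<le> (1 + m) * (1 / 2) ^ k" by (simp add: m_def)
    finally show ?thesis by (simp add: ennreal_leI)
  qed
  have "(\<integral>\<^sup>+x. (\<Sum>k. ennreal (cmod (d k x))) \<partial>M) = (\<Sum>k. \<integral>\<^sup>+x. ennreal (cmod (d k x)) \<partial>M)"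
    by (rule nn_integral_suminf) simp
  also have "\<dots> \<le> (\<Sum>k. ennreal ((1 + m) * (1 / 2) ^ k))"
    by (intro suminf_le d_int) auto
  also have "\<dots> < top"
  proof -
    have "summable (\<lambda>k. (1 + m) * (1 / 2 :: real) ^ k)" by (intro summable_mult summable_geometric) auto
    then show ?thesis by (subst less_top[symmetric], intro ennreal_suminf_neq_top) (auto simp: m_def)
  qed
  finally have "AE x in M. (\<Sum>k. ennreal (cmod (d k x))) \<noteq> \<infinity>"
    by (intro nn_integral_noteq_infinite) auto
  then have "AE x in M. summable (\<lambda>k. d k x)"
  proof eventually_elim
    case (elim x)
    then have "summable (\<lambda>k. cmod (d k x))" by (intro summable_suminf_not_top) auto
    then show ?case by (rule summable_norm_cancel)
  qed
  then have conv: "AE x in M. (\<lambda>k. s (r k) x) \<longlonglongrightarrow> lim (\<lambda>k. s (r k) x)"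
  proof eventually_elim
    case (elim x)
    then have "(\<lambda>n. \<Sum>k<n. d k x) \<longlonglongrightarrow> (\<Sum>k. d k x)" by (rule summable_LIMSEQ)
    then have "(\<lambda>n. (s (r n) x - s (r 0) x) + s (r 0) x) \<longlonglongrightarrow> (\<Sum>k. d k x) + s (r 0) x"
      by (intro tendsto_add tendsto_const) (simp add: d_def sum_lessThan_telescope[of "\<lambda>k. s (r k) x"])
    then have "convergent (\<lambda>n. s (r n) x)" by (auto simp: convergent_def)
    then show ?case by (simp add: convergent_LIMSEQ_iff)
  qed
  \<comment> \<open>Where the subsequence diverges, \<open>lim\<close> returns an unspecified value;
    this happens only on a null set, and \<open>f\<close> is still measurable.\<close>
  define f where "f x = lim (\<lambda>k. s (r k) x)" for x
  have f_meas [measurable]: "f \<in> borel_measurable M" unfolding f_def[abs_def] by measurable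
  \<comment> \<open>Fatou along the subsequence: the integrand is almost everywhere the limit of
    \<open>(cmod (s n x - s (r k) x))\<^sup>2\<close>, whose integrals are at most \<open>e\<close>
    once \<open>r k\<close> exceeds \<open>N\<close>.\<close>
  have tail: "(\<integral>\<^sup>+x. ennreal ((cmod (s n x - f x))\<^sup>2) \<partial>M) \<le> ennreal e"
    if N: "\<And>m. m \<ge> N \<Longrightarrow> l2_sq M (\<lambda>x. s n x - s m x) \<le> e" for n e N
  proof -
    have "(\<integral>\<^sup>+x. ennreal ((cmod (s n x - f x))\<^sup>2) \<partial>M)
        = (\<integral>\<^sup>+x. liminf (\<lambda>k. ennreal ((cmod (s n x - s (r k) x))\<^sup>2)) \<partial>M)"
    proof (rule nn_integral_cong_AE)
      show "AE x in M. ennreal ((cmod (s n x - f x))\<^sup>2) = liminf (\<lambda>k. ennreal ((cmod (s n x - s (r k) x))\<^sup>2))"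
        using conv
      proof eventually_elim
        case (elim x)
        have "(\<lambda>k. ennreal ((cmod (s n x - s (r k) x))\<^sup>2)) \<longlonglongrightarrow> ennreal ((cmod (s n x - f x))\<^sup>2)"
          using elim unfolding f_def by (intro tendsto_intros)
        then show ?case by (intro lim_imp_Liminf[symmetric]) simp_all
      qed
    qed
    also have "\<dots> \<le> liminf (\<lambda>k. \<integral>\<^sup>+x. ennreal ((cmod (s n x - s (r k) x))\<^sup>2) \<partial>M)"
      by (rule nn_integral_liminf) simp
    also have "\<dots> \<le> limsup (\<lambda>k. \<integral>\<^sup>+x. ennreal ((cmod (s n x - s (r k) x))\<^sup>2) \<partial>M)"
      by (rule Liminf_le_Limsup) simp
    also have "\<dots> \<le> ennreal e"
    proof (rule Limsup_bounded)
      show "\<forall>\<^sub>F k in sequentially. (\<integral>\<^sup>+x. ennreal ((cmod (s n x - s (r k) x))\<^sup>2) \<partial>M) \<le> ennreal e"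
        using eventually_ge_at_top[of N]
      proof eventually_elim
        case (elim k)
        then have "l2_sq M (\<lambda>x. s n x - s (r k) x) \<le> e" using N[of "r k"] r_id[of k] by simp
        then show ?case
          by (simp add: nn_integral_sq[OF sq_integrable_diff[OF s s]] ennreal_leI)
      qed
    qed
    finally show ?thesis .
  qed
  have diff_sq: "sq_integrable M (\<lambda>x. s n x - f x)" and diff_le: "l2_sq M (\<lambda>x. s n x - f x) \<le> e"
    if N: "\<And>m. m \<ge> N \<Longrightarrow> l2_sq M (\<lambda>x. s n x - s m x) \<le> e" for n e N
  proof -
    have e: "0 \<le> e" using N[of N] l2_sq_nonneg order_trans by blast
    have le: "(\<integral>\<^sup>+x. ennreal ((cmod (s n x - f x))\<^sup>2) \<partial>M) \<le> ennreal e"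
      using N by (rule tail)
    have "integrable M (\<lambda>x. (cmod (s n x - f x))\<^sup>2)"
      using le_less_trans[OF le ennreal_less_top] by (intro integrableI_bounded) auto
    then show *: "sq_integrable M (\<lambda>x. s n x - f x)" by (simp add: sq_integrable_def)
    show "l2_sq M (\<lambda>x. s n x - f x) \<le> e"
      using le e unfolding nn_integral_sq[OF *] by simp
  qed
  have ev: "\<exists>N. \<forall>n\<ge>N. \<forall>m\<ge>N. l2_sq M (\<lambda>x. s n x - s m x) \<le> e" if "0 < e" for e
    using cauchy[OF that] by (meson less_imp_le)
  show thesis
  proof
    obtain N where "\<forall>n\<ge>N. \<forall>m\<ge>N. l2_sq M (\<lambda>x. s n x - s m x) \<le> 1" using ev[of 1] by auto
    then have "sq_integrable M (\<lambda>x. s N x - f x)" by (intro diff_sq[of N]) auto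
    from sq_integrable_diff[OF s[of N] this] show "sq_integrable M f" by simp
    show "(\<lambda>n. l2_sq M (\<lambda>x. s n x - f x)) \<longlonglongrightarrow> 0"
    proof (rule LIMSEQ_I)
      fix e :: real assume "0 < e"
      then obtain N where N: "\<forall>n\<ge>N. \<forall>m\<ge>N. l2_sq M (\<lambda>x. s n x - s m x) \<le> e / 2" using ev[of "e / 2"] by auto
      have "l2_sq M (\<lambda>x. s n x - f x) \<le> e / 2" if "n \<ge> N" for n
        using N that by (intro diff_le[of N]) auto
      then show "\<exists>N. \<forall>n\<ge>N. norm (l2_sq M (\<lambda>x. s n x - f x) - 0) < e"
        using \<open>0 < e\<close> by (intro exI[of _ N]) (fastforce simp: abs_of_nonneg[OF l2_sq_nonneg])
    qed
  qed
qed

section \<open>Orthonormal systems, Bessel and Parseval\<close>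

lemma l2_sq_diff:
  assumes "sq_integrable M f" "sq_integrable M g"
  shows "l2_sq M (\<lambda>x. f x - g x) = l2_sq M f - 2 * Re (l2_inner M f g) + l2_sq M g"
proof -
  have d: "sq_integrable M (\<lambda>x. f x - g x)" by (rule sq_integrable_diff[OF assms])
  have "of_real (l2_sq M (\<lambda>x. f x - g x)) = l2_inner M f (\<lambda>x. f x - g x) - l2_inner M g (\<lambda>x. f x - g x)"
    using assms d by (simp add: l2_inner_diff_left flip: l2_inner_self)
  also have "\<dots> = cnj (l2_inner M f f - l2_inner M g f) - cnj (l2_inner M f g - l2_inner M g g)"
    using assms d by (simp add: l2_inner_commute[of M _ "\<lambda>x. f x - g x"] l2_inner_diff_left)
  also have "\<dots> = of_real (l2_sq M f - 2 * Re (l2_inner M f g) + l2_sq M g)"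
    using complex_add_cnj[of "l2_inner M f g"]
    by (simp add: l2_inner_self l2_inner_commute[of M g f] algebra_simps)
  finally show ?thesis by (simp only: of_real_eq_iff)
qed

definition orthonormal_system :: "'a measure \<Rightarrow> 'i set \<Rightarrow> ('i \<Rightarrow> 'a \<Rightarrow> complex) \<Rightarrow> bool" where
  "orthonormal_system M J e \<longleftrightarrow> (\<forall>n\<in>J. sq_integrable M (e n)) \<and>
     (\<forall>n\<in>J. \<forall>m\<in>J. l2_inner M (e n) (e m) = (if n = m then 1 else 0))"

lemma l2_inner_orthonormal_sum:
  assumes e: "orthonormal_system M J e" and A: "finite A" "A \<subseteq> J" and n: "n \<in> J"
  shows "l2_inner M (\<lambda>x. \<Sum>i\<in>A. c i * e i x) (e n) = (if n \<in> A then c n else 0)"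
proof -
  have [simp]: "sq_integrable M (e i)" if "i \<in> J" for i using e that by (simp add: orthonormal_system_def)
  have "l2_inner M (\<lambda>x. \<Sum>i\<in>A. c i * e i x) (e n) = (\<Sum>i\<in>A. l2_inner M (\<lambda>x. c i * e i x) (e n))"
    using A n by (intro l2_inner_sum_left sq_integrable_cmult) auto
  also have "\<dots> = (\<Sum>i\<in>A. if i = n then c i else 0)"
    using A n e by (intro sum.cong) (auto simp: l2_inner_cmult_left orthonormal_system_def)
  finally show ?thesis using A by (simp add: sum.delta)
qed

lemma l2_sq_orthonormal_sum:
  assumes e: "orthonormal_system M J e" and A: "finite A" "A \<subseteq> J"
  shows "l2_sq M (\<lambda>x. \<Sum>i\<in>A. c i * e i x) = (\<Sum>i\<in>A. (cmod (c i))\<^sup>2)"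
proof -
  let ?s = "\<lambda>x. \<Sum>i\<in>A. c i * e i x"
  have [simp]: "sq_integrable M (e i)" if "i \<in> J" for i using e that by (simp add: orthonormal_system_def)
  have s: "sq_integrable M ?s" using A by (intro sq_integrable_sum sq_integrable_cmult) auto
  have "l2_inner M ?s ?s = (\<Sum>i\<in>A. l2_inner M (\<lambda>x. c i * e i x) ?s)"
    using A s by (intro l2_inner_sum_left sq_integrable_cmult) auto
  also have "\<dots> = (\<Sum>i\<in>A. c i * cnj (c i))"
    using A by (intro sum.cong)
      (auto simp: l2_inner_cmult_left l2_inner_commute[of M _ ?s] l2_inner_orthonormal_sum[OF e A] subsetD)
  finally have "of_real (l2_sq M ?s) = (of_real (\<Sum>i\<in>A. (cmod (c i))\<^sup>2) :: complex)"
    by (simp add: l2_inner_self complex_norm_square del: of_real_power)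
  then show ?thesis by (simp only: of_real_eq_iff)
qed

text \<open>Pythagoras for the projection onto a finite part of the system. Nonnegativity of the
  left side is Bessel's inequality, and the exact formula later converts norm convergence into
  Parseval's identity.\<close>

lemma l2_sq_diff_orthonormal_sum:
  assumes e: "orthonormal_system M J e" and A: "finite A" "A \<subseteq> J" and f: "sq_integrable M f"
  shows "l2_sq M (\<lambda>x. f x - (\<Sum>i\<in>A. l2_inner M f (e i) * e i x))
    = l2_sq M f - (\<Sum>i\<in>A. (cmod (l2_inner M f (e i)))\<^sup>2)"
proof -
  let ?s = "\<lambda>x. \<Sum>i\<in>A. l2_inner M f (e i) * e i x"
  have [simp]: "sq_integrable M (e i)" if "i \<in> J" for i using e that by (simp add: orthonormal_system_def)
  have s: "sq_integrable M ?s" using A by (intro sq_integrable_sum sq_integrable_cmult) auto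
  have "l2_inner M ?s f = (\<Sum>i\<in>A. l2_inner M (\<lambda>x. l2_inner M f (e i) * e i x) f)"
    using A f by (intro l2_inner_sum_left sq_integrable_cmult) auto
  also have "\<dots> = of_real (\<Sum>i\<in>A. (cmod (l2_inner M f (e i)))\<^sup>2)"
    by (simp add: l2_inner_cmult_left l2_inner_commute[of M _ f] complex_norm_square del: of_real_power)
  finally have "Re (l2_inner M f ?s) = (\<Sum>i\<in>A. (cmod (l2_inner M f (e i)))\<^sup>2)"
    by (simp add: l2_inner_commute[of M f ?s])
  then show ?thesis using l2_sq_diff[OF f s] l2_sq_orthonormal_sum[OF e A] by simp
qed

text \<open>Completeness of the system is only required inside the closed subspace of functions
  orthogonal to \<open>U\<close>; this covers orthonormal bases of the Hardy space.\<close>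

theorem (in finite_measure) parseval:
  fixes e :: "nat \<Rightarrow> 'a \<Rightarrow> complex"
  assumes e: "orthonormal_system M J e" and f: "sq_integrable M f"
    and U: "\<And>u. u \<in> U \<Longrightarrow> sq_integrable M u"
    and fU: "\<And>u. u \<in> U \<Longrightarrow> l2_inner M f u = 0"
    and eU: "\<And>u n. u \<in> U \<Longrightarrow> n \<in> J \<Longrightarrow> l2_inner M (e n) u = 0"
    and complete: "\<And>g. sq_integrable M g \<Longrightarrow> (\<And>u. u \<in> U \<Longrightarrow> l2_inner M g u = 0) \<Longrightarrow>
        (\<And>n. n \<in> J \<Longrightarrow> l2_inner M g (e n) = 0) \<Longrightarrow> AE x in M. g x = 0"
  shows "(\<lambda>N. l2_sq M (\<lambda>x. (\<Sum>i\<in>J \<inter> {..<N}. l2_inner M f (e i) * e i x) - f x)) \<longlonglongrightarrow> 0"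
    and "(\<lambda>n. if n \<in> J then (cmod (l2_inner M f (e n)))\<^sup>2 else 0) sums l2_sq M f"
proof -
  define c where "c n = l2_inner M f (e n)" for n
  define a where "a n = (if n \<in> J then (cmod (c n))\<^sup>2 else 0)" for n
  define s where "s N x = (\<Sum>i\<in>J \<inter> {..<N}. c i * e i x)" for N x
  have e_sq: "sq_integrable M (e i)" if "i \<in> J" for i using e that by (simp add: orthonormal_system_def)
  have s_sq: "sq_integrable M (s N)" for N
    unfolding s_def[abs_def] by (intro sq_integrable_sum sq_integrable_cmult e_sq) auto
  have a_sum: "(\<Sum>n<N. a n) = (\<Sum>i\<in>J \<inter> {..<N}. (cmod (c i))\<^sup>2)" for N
    unfolding a_def by (simp add: sum.inter_restrict[symmetric] Int_commute)
  have dist: "l2_sq M (\<lambda>x. f x - s N x) = l2_sq M f - (\<Sum>n<N. a n)" for N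
    unfolding s_def c_def using l2_sq_diff_orthonormal_sum[OF e _ _ f, of "J \<inter> {..<N}"]
    by (simp add: a_sum c_def)
  have a_nonneg: "0 \<le> a n" for n by (simp add: a_def)
  \<comment> \<open>Bessel's inequality bounds the partial sums.\<close>
  have "summable a"
  proof (rule bounded_imp_summable)
    show "(\<Sum>k\<le>n. a k) \<le> l2_sq M f" for n
      using dist[of "Suc n"] l2_sq_nonneg[of M "\<lambda>x. f x - s (Suc n) x"] by (simp add: lessThan_Suc_atMost)
  qed (rule a_nonneg)
  then have cauchy_a: "\<exists>N. \<forall>m\<ge>N. \<forall>n\<ge>N. \<bar>(\<Sum>k<m. a k) - (\<Sum>k<n. a k)\<bar> < r" if "0 < r" for r
    using that summable_LIMSEQ[of a, THEN LIMSEQ_imp_Cauchy] unfolding Cauchy_def dist_real_def by blast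
  \<comment> \<open>Distances between partial sums of the expansion are distances between partial
    sums of a convergent real series, so the expansion is Cauchy in L2.\<close>
  have s_diff: "l2_sq M (\<lambda>x. s m x - s n x) = \<bar>(\<Sum>k<m. a k) - (\<Sum>k<n. a k)\<bar>" for m n
  proof -
    have *: "l2_sq M (\<lambda>x. s m x - s n x) = (\<Sum>k<m. a k) - (\<Sum>k<n. a k)" if "n \<le> m" for m n
    proof -
      have fin: "finite (J \<inter> {n..<m})" "J \<inter> {n..<m} \<subseteq> J" by auto
      have dj: "J \<inter> {..<m} = (J \<inter> {..<n}) \<union> (J \<inter> {n..<m})" using that by auto
      have "s m x - s n x = (\<Sum>i\<in>J \<inter> {n..<m}. c i * e i x)" for x
        unfolding s_def dj by (subst sum.union_disjoint) auto
      then have "l2_sq M (\<lambda>x. s m x - s n x) = (\<Sum>i\<in>J \<inter> {n..<m}. (cmod (c i))\<^sup>2)"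
        using l2_sq_orthonormal_sum[OF e fin] by simp
      moreover have "(\<Sum>k<m. a k) - (\<Sum>k<n. a k) = (\<Sum>i\<in>J \<inter> {n..<m}. (cmod (c i))\<^sup>2)"
        unfolding a_sum dj by (subst sum.union_disjoint) auto
      ultimately show ?thesis by simp
    qed
    show ?thesis
    proof (cases "n \<le> m")
      case True
      then show ?thesis using *[OF True] l2_sq_nonneg[of M "\<lambda>x. s m x - s n x"] by simp
    next
      case False
      then have "m \<le> n" by simp
      from *[OF this] show ?thesis
        using l2_sq_nonneg[of M "\<lambda>x. s n x - s m x"] l2_sq_commute_diff[of M "s m" "s n"] by simp
    qed
  qed
  \<comment> \<open>The limit \<open>g\<close> is not yet known to be \<open>f\<close>. By
    continuity of the inner product it inherits from the partial sums orthogonality to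
    \<open>U\<close> and the coefficients of \<open>f\<close>.\<close>
  obtain g where g: "sq_integrable M g" and lim: "(\<lambda>n. l2_sq M (\<lambda>x. s n x - g x)) \<longlonglongrightarrow> 0"
    by (rule riesz_fischer[of s]) (use s_sq cauchy_a s_diff in auto)
  have inner_lim: "(\<lambda>N. l2_inner M (s N) h) \<longlonglongrightarrow> l2_inner M g h" if "sq_integrable M h" for h
    by (rule l2_inner_tendsto[OF s_sq g that lim])
  have gU: "l2_inner M g u = 0" if u: "u \<in> U" for u
  proof -
    have "l2_inner M (s N) u = 0" for N
    proof -
      have "l2_inner M (s N) u = (\<Sum>i\<in>J \<inter> {..<N}. l2_inner M (\<lambda>x. c i * e i x) u)"
        unfolding s_def[abs_def] by (intro l2_inner_sum_left sq_integrable_cmult e_sq U u) auto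
      then show ?thesis by (simp add: l2_inner_cmult_left eU[OF u])
    qed
    then show ?thesis using inner_lim[OF U[OF u]] by (simp add: LIMSEQ_const_iff)
  qed
  have ge: "l2_inner M g (e n) = c n" if n: "n \<in> J" for n
  proof (rule LIMSEQ_unique[OF inner_lim[OF e_sq[OF n]]])
    have "\<forall>\<^sub>F N in sequentially. l2_inner M (s N) (e n) = c n"
      using eventually_gt_at_top[of n]
    proof eventually_elim
      case (elim N)
      then show ?case unfolding s_def[abs_def]
        using l2_inner_orthonormal_sum[OF e, of "J \<inter> {..<N}" n c] n by simp
    qed
    then show "(\<lambda>N. l2_inner M (s N) (e n)) \<longlonglongrightarrow> c n" by (rule tendsto_eventually)
  qed
  \<comment> \<open>The difference is orthogonal to \<open>U\<close> and to the whole system, which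
    is the situation that the completeness hypothesis covers.\<close>
  have fg: "AE x in M. f x - g x = 0"
    by (rule complete) (use f g U fU gU ge e_sq in \<open>auto simp: sq_integrable_diff l2_inner_diff_left c_def\<close>)
  have [measurable]: "f \<in> borel_measurable M" "g \<in> borel_measurable M" "s N \<in> borel_measurable M" for N
    using f g s_sq by (auto simp: sq_integrable_def)
  have "l2_sq M (\<lambda>x. s N x - g x) = l2_sq M (\<lambda>x. s N x - f x)" for N
    unfolding l2_sq_def by (rule integral_cong_AE) (use fg in auto)
  with lim have lim': "(\<lambda>n. l2_sq M (\<lambda>x. s n x - f x)) \<longlonglongrightarrow> 0" by simp
  then show "(\<lambda>N. l2_sq M (\<lambda>x. (\<Sum>i\<in>J \<inter> {..<N}. l2_inner M f (e i) * e i x) - f x)) \<longlonglongrightarrow> 0"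
    by (simp add: s_def c_def)
  have "(\<lambda>N. l2_sq M f - l2_sq M (\<lambda>x. s N x - f x)) \<longlonglongrightarrow> l2_sq M f - 0"
    by (intro tendsto_diff tendsto_const lim')
  then have "(\<lambda>N. \<Sum>n<N. a n) \<longlonglongrightarrow> l2_sq M f"
    by (simp add: l2_sq_commute_diff[of M _ f] dist)
  then show "(\<lambda>n. if n \<in> J then (cmod (l2_inner M f (e n)))\<^sup>2 else 0) sums l2_sq M f"
    unfolding sums_def a_def c_def .
qed

section \<open>Normalized arclength on the circle\<close>

lemma integrable_mult_bounded:
  fixes f b :: "'a \<Rightarrow> complex"
  assumes "integrable M f" "b \<in> borel_measurable M" "\<And>x. x \<in> space M \<Longrightarrow> cmod (b x) \<le> C"
  shows "integrable M (\<lambda>x. b x * f x)"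
proof (rule Bochner_Integration.integrable_bound)
  show "integrable M (\<lambda>x. C * cmod (f x))" using assms(1) by simp
  show "AE x in M. norm (b x * f x) \<le> norm (C * cmod (f x))"
  proof (rule AE_I2)
    fix x assume "x \<in> space M"
    then have "cmod (b x) \<le> \<bar>C\<bar>" using assms(3) by force
    then show "norm (b x * f x) \<le> norm (C * cmod (f x))" by (simp add: norm_mult abs_mult mult_right_mono)
  qed
qed (use assms in auto)

text \<open>The \<sigma>-algebra is the largest one making \<open>cis\<close> measurable, so that a function \<open>F\<close> on the circle is
  measurable iff \<open>F \<circ> cis\<close> is measurable on \<open>[0, 2\<pi>]\<close>.\<close>

definition circle_sets :: "complex set set" where
  "circle_sets = {A. A \<subseteq> sphere 0 1 \<and> cis -` A \<inter> {0..2*pi} \<in> sets lborel}"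

text \<open>The underlying space is the circle itself rather than the plane, so that
  \<open>cmod z = 1\<close> holds at every point of it, not just almost everywhere. Both endpoints
  of the parameter interval map to 1, which affects only a null set.\<close>

definition circle_measure :: "complex measure" where
  "circle_measure = distr (density (restrict_space lborel {0..2*pi}) (\<lambda>_. ennreal (1 / (2*pi))))
     (sigma (sphere 0 1) circle_sets) cis"

lemma sigma_algebra_circle_sets: "sigma_algebra (sphere 0 1) circle_sets"
  unfolding sigma_algebra_iff2
proof (intro conjI ballI allI impI)
  show "circle_sets \<subseteq> Pow (sphere 0 1)" "{} \<in> circle_sets" by (auto simp: circle_sets_def)
next
  fix A assume A: "A \<in> circle_sets"
  have "cis -` (sphere 0 1 - A) \<inter> {0..2*pi} = {0..2*pi} - (cis -` A \<inter> {0..2*pi})"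
    by auto
  then show "sphere 0 1 - A \<in> circle_sets" using A by (auto simp: circle_sets_def)
next
  fix A :: "nat \<Rightarrow> complex set" assume A: "range A \<subseteq> circle_sets"
  have "cis -` (\<Union>i. A i) \<inter> {0..2*pi} = (\<Union>i. cis -` A i \<inter> {0..2*pi})" by auto
  moreover have "\<And>i. cis -` A i \<inter> {0..2*pi} \<in> sets lborel" using A by (auto simp: circle_sets_def)
  then have "(\<Union>i. cis -` A i \<inter> {0..2*pi}) \<in> sets lborel" by (intro sets.countable_UN) auto
  ultimately have "cis -` (\<Union>i. A i) \<inter> {0..2*pi} \<in> sets lborel" by simp
  moreover have "(\<Union>i. A i) \<subseteq> sphere 0 1" using A by (auto simp: circle_sets_def)
  ultimately show "(\<Union>i. A i) \<in> circle_sets" unfolding circle_sets_def by blast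
qed

lemma space_circle [simp]: "space circle_measure = sphere 0 1"
  and sets_circle: "sets circle_measure = circle_sets"
  using sigma_algebra.sets_measure_of_eq[OF sigma_algebra_circle_sets]
    sigma_algebra.space_measure_of_eq[OF sigma_algebra_circle_sets]
  by (simp_all add: circle_measure_def)

abbreviation arc :: "real measure" where
  "arc \<equiv> restrict_space lborel {0..2*pi}"

lemma measurable_cis_circle: "cis \<in> measurable arc (sigma (sphere 0 1) circle_sets)"
proof (rule measurableI)
  fix A assume "A \<in> sets (sigma (sphere 0 1) circle_sets)"
  then have "A \<in> circle_sets"
    by (simp add: sigma_algebra.sets_measure_of_eq[OF sigma_algebra_circle_sets])
  then show "cis -` A \<inter> space arc \<in> sets arc"
    by (auto simp: circle_sets_def sets_restrict_space space_restrict_space intro!: image_eqI[of _ _ "cis -` A \<inter> {0..2*pi}"])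
qed (simp add: sigma_algebra.space_measure_of_eq[OF sigma_algebra_circle_sets])

lemma measurable_circle_iff:
  fixes F :: "complex \<Rightarrow> 'b::topological_space"
  shows "F \<in> borel_measurable circle_measure \<longleftrightarrow> (\<lambda>t. F (cis t)) \<in> borel_measurable arc"
proof
  assume "F \<in> borel_measurable circle_measure"
  then have "F \<in> measurable (sigma (sphere 0 1) circle_sets) borel" by (simp add: circle_measure_def)
  then show "(\<lambda>t. F (cis t)) \<in> borel_measurable arc"
    by (rule measurable_compose[OF measurable_cis_circle])
next
  assume m: "(\<lambda>t. F (cis t)) \<in> borel_measurable arc"
  show "F \<in> borel_measurable circle_measure"
  proof (rule measurableI)
    fix B :: "'b set" assume "B \<in> sets borel"
    with m have "(\<lambda>t. F (cis t)) -` B \<inter> space arc \<in> sets arc" by (rule measurable_sets)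
    then have "(\<lambda>t. F (cis t)) -` B \<inter> {0..2*pi} \<in> sets lborel"
      by (auto simp: space_restrict_space sets_restrict_space)
    moreover have "cis -` (F -` B \<inter> sphere 0 1) \<inter> {0..2*pi} = (\<lambda>t. F (cis t)) -` B \<inter> {0..2*pi}" by auto
    ultimately show "F -` B \<inter> space circle_measure \<in> sets circle_measure"
      by (simp add: sets_circle circle_sets_def)
  qed simp
qed

lemma measurable_circle_iff_set:
  fixes F :: "complex \<Rightarrow> 'b::real_normed_vector"
  shows "F \<in> borel_measurable circle_measure \<longleftrightarrow> set_borel_measurable lborel {0..2*pi} (\<lambda>t. F (cis t))"
  unfolding measurable_circle_iff set_borel_measurable_def
  by (rule borel_measurable_restrict_space_iff) simp

lemma integrable_circle_iff:
  fixes F :: "complex \<Rightarrow> 'b::{banach, second_countable_topology}"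
  shows "integrable circle_measure F \<longleftrightarrow> set_integrable lborel {0..2*pi} (\<lambda>t. F (cis t))"
proof (cases "F \<in> borel_measurable circle_measure")
  case True
  then have F: "F \<in> borel_measurable (sigma (sphere 0 1) circle_sets)" and Fc: "(\<lambda>t. F (cis t)) \<in> borel_measurable arc"
    by (simp add: circle_measure_def) (use True measurable_circle_iff in blast)
  have "integrable circle_measure F \<longleftrightarrow> integrable arc (\<lambda>t. (1 / (2*pi)) *\<^sub>R F (cis t))"
    unfolding circle_measure_def using F Fc measurable_cis_circle
    by (simp add: integrable_distr_eq integrable_density del: divide_const_simps)
  also have "\<dots> \<longleftrightarrow> integrable arc (\<lambda>t. F (cis t))"
  proof
    assume "integrable arc (\<lambda>t. (1 / (2*pi)) *\<^sub>R F (cis t))"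
    then have "integrable arc (\<lambda>t. (2*pi) *\<^sub>R (1 / (2*pi)) *\<^sub>R F (cis t))"
      by (rule integrable_scaleR_right)
    then show "integrable arc (\<lambda>t. F (cis t))" by simp
  qed (intro integrable_scaleR_right, auto)
  also have "\<dots> \<longleftrightarrow> set_integrable lborel {0..2*pi} (\<lambda>t. F (cis t))"
    unfolding set_integrable_def by (rule integrable_restrict_space) simp
  finally show ?thesis .
next
  case False
  \<comment> \<open>Since the \<sigma>-algebra is the largest possible one, a function that is not
    measurable on the circle is not measurable in the parameter either, and integrability fails on
    both sides.\<close>
  then have "\<not> set_integrable lborel {0..2*pi} (\<lambda>t. F (cis t))"
    unfolding measurable_circle_iff_set set_borel_measurable_def set_integrable_def
    using borel_measurable_integrable by blast
  with False show ?thesis using borel_measurable_integrable by blast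
qed

lemma integral_circle:
  fixes F :: "complex \<Rightarrow> 'b::{banach, second_countable_topology}"
  shows "integral\<^sup>L circle_measure F = (1 / (2*pi)) *\<^sub>R (LINT t:{0..2*pi}|lborel. F (cis t))"
proof (cases "F \<in> borel_measurable circle_measure")
  case True
  then have F: "F \<in> borel_measurable (sigma (sphere 0 1) circle_sets)" and Fc: "(\<lambda>t. F (cis t)) \<in> borel_measurable arc"
    by (simp add: circle_measure_def) (use True measurable_circle_iff in blast)
  have "integral\<^sup>L circle_measure F = (\<integral>t. (1 / (2*pi)) *\<^sub>R F (cis t) \<partial>arc)"
    unfolding circle_measure_def using F Fc measurable_cis_circle
    by (simp add: integral_distr integral_density del: divide_const_simps integral_scaleR_right)
  also have "\<dots> = (1 / (2*pi)) *\<^sub>R (\<integral>t. F (cis t) \<partial>arc)" by simp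
  also have "(\<integral>t. F (cis t) \<partial>arc) = (LINT t:{0..2*pi}|lborel. F (cis t))"
    unfolding set_lebesgue_integral_def by (rule integral_restrict_space) simp
  finally show ?thesis .
next
  case False
  \<comment> \<open>Both integrals have the default value 0 here, so the formula holds for every
    function, as required for \<open>circ_int\<close>.\<close>
  then have "\<not> integrable circle_measure F" using borel_measurable_integrable by blast
  then show ?thesis using integrable_circle_iff[of F]
    by (simp add: not_integrable_integral_eq set_integrable_def set_lebesgue_integral_def)
qed

lemma circ_int_eq: "circ_int F = integral\<^sup>L circle_measure F"
  by (simp add: circ_int_def integral_circle scaleR_conv_of_real)

lemma AE_circle_iff:
  assumes "{z \<in> sphere 0 1. P z} \<in> sets circle_measure"
  shows "(AE z in circle_measure. P z) \<longleftrightarrow> (AE t in lborel. t \<in> {0..2*pi} \<longrightarrow> P (cis t))"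
proof -
  let ?N = "sigma (sphere 0 1) circle_sets"
  have sp: "space ?N = sphere 0 1" "sets ?N = sets circle_measure"
    using sigma_algebra.space_measure_of_eq[OF sigma_algebra_circle_sets]
    by (simp_all add: circle_measure_def)
  have "(AE z in circle_measure. P z)
      \<longleftrightarrow> (AE t in density arc (\<lambda>_. ennreal (1 / (2*pi))). P (cis t))"
    unfolding circle_measure_def using assms measurable_cis_circle
    by (intro AE_distr_iff) (simp_all add: sp)
  also have "\<dots> \<longleftrightarrow> (AE t in arc. P (cis t))"
    by (subst AE_density) auto
  also have "\<dots> \<longleftrightarrow> (AE t in lborel. t \<in> {0..2*pi} \<longrightarrow> P (cis t))"
    by (rule AE_restrict_space_iff) simp
  finally show ?thesis .
qed

lemma measurable_circle_continuous:
  fixes F :: "complex \<Rightarrow> 'b::topological_space"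
  assumes "continuous_on (sphere 0 1) F"
  shows "F \<in> borel_measurable circle_measure"
proof -
  have "continuous_on {0..2*pi} (\<lambda>t. F (cis t))"
    by (rule continuous_on_compose2[OF assms]) (auto intro!: continuous_intros)
  then have "(\<lambda>t. F (cis t)) \<in> borel_measurable (restrict_space borel {0..2*pi})"
    by (rule borel_measurable_continuous_on_restrict)
  then show ?thesis
    unfolding measurable_circle_iff by (simp add: measurable_cong_sets[OF sets_restrict_space_cong[OF sets_lborel] refl])
qed

lemma continuous_on_sphere_powi: "continuous_on (sphere 0 1) (\<lambda>z::complex. z powi n)"
  by (rule continuous_on_power_int) (auto intro!: continuous_intros)

lemma borel_measurable_powi_circle [measurable]: "(\<lambda>z. z powi n) \<in> borel_measurable circle_measure"
  by (rule measurable_circle_continuous[OF continuous_on_sphere_powi])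

lemma borel_measurable_ident_circle [measurable]: "(\<lambda>z. z) \<in> borel_measurable circle_measure"
  by (rule measurable_circle_continuous) (rule continuous_on_id)

lemma prob_circle: "emeasure circle_measure (space circle_measure) = 1"
proof -
  have "(\<integral>z. 1 \<partial>circle_measure) = (1::real)"
    by (subst integral_circle) (simp add: set_lebesgue_integral_def)
  then have "measure circle_measure (space circle_measure) = 1" by simp
  moreover from this have "emeasure circle_measure (space circle_measure) \<noteq> top"
    by (auto simp: measure_def)
  ultimately show ?thesis by (simp add: emeasure_eq_ennreal_measure)
qed

lemma finite_measure_circle: "finite_measure circle_measure"
  by (rule finite_measureI) (simp only: prob_circle, simp)

lemma norm_powi_circle: "cmod z = 1 \<Longrightarrow> cmod (z powi n) = 1"
  by (simp add: norm_power_int)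

lemma cnj_powi_circle:
  assumes "cmod z = 1"
  shows "cnj (z powi n) = z powi (- n)"
proof -
  have "inverse z = cnj z" by (rule inverse_unique) (use complex_norm_square[of z] assms in simp)
  then show ?thesis by (simp only: complex_cnj_power_int power_int_minus flip: power_int_inverse)
qed

lemma powi_add_circle: "cmod z = 1 \<Longrightarrow> z powi (m + n) = z powi m * z powi n"
  by (rule power_int_add) auto

section \<open>Uniqueness of Fourier coefficients of integrable functions\<close>

lemma integrable_mult_powi:
  "integrable circle_measure f \<Longrightarrow> integrable circle_measure (\<lambda>z. f z * z powi n)"
  using integrable_mult_bounded[of circle_measure f "\<lambda>z. z powi n" 1]
  by (simp add: norm_powi_circle mult.commute)

text \<open>On the circle a real linear form is a combination of z and \<open>z powi (- 1)\<close>,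
  so multiplying by it only mixes neighbouring coefficients. The conclusion carries integrability
  and all coefficients because the product case feeds it back in as a hypothesis.\<close>

lemma fourier_zero_mult_polynomial:
  assumes "real_polynomial_function p" "integrable circle_measure f"
    and "\<And>n::int. (\<integral>z. f z * z powi n \<partial>circle_measure) = 0"
  shows "integrable circle_measure (\<lambda>z. of_real (p z) * f z)
    \<and> (\<forall>n::int. (\<integral>z. of_real (p z) * f z * z powi n \<partial>circle_measure) = 0)"
  using assms
proof (induction p arbitrary: f rule: real_polynomial_function.induct)
  case (linear p)
  \<comment> \<open>These solve
    \<open>Re z * p 1 + Im z * p \<i> = \<alpha> * z + \<beta> * cnj z\<close>, the linear form
    written in z and its conjugate.\<close>
  define \<alpha> where "\<alpha> = (of_real (p 1) - \<i> * of_real (p \<i>)) / 2"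
  define \<beta> where "\<beta> = (of_real (p 1) + \<i> * of_real (p \<i>)) / 2"
  interpret p: bounded_linear p by fact
  have pz: "of_real (p z) * f z * z powi n = \<alpha> * (f z * z powi (n + 1)) + \<beta> * (f z * z powi (n - 1))"
    if "cmod z = 1" for z and n :: int
  proof -
    have "p z = p (Re z *\<^sub>R 1 + Im z *\<^sub>R \<i>)" by (rule arg_cong[of _ _ p]) (simp add: complex_eq_iff)
    also have "\<dots> = Re z * p 1 + Im z * p \<i>" by (simp only: p.add p.scaleR) simp
    finally have "of_real (p z) = of_real (Re z) * complex_of_real (p 1) + of_real (Im z) * of_real (p \<i>)" by simp
    also have "\<dots> = \<alpha> * z + \<beta> * cnj z"
      by (simp add: \<alpha>_def \<beta>_def complex_eq_iff field_simps)
    also have "cnj z = z powi (- 1)" using cnj_powi_circle[OF that, of 1] by simp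
    finally have "of_real (p z) = \<alpha> * z + \<beta> * z powi (- 1)" .
    moreover have "z powi (n + 1) = z powi n * z" "z powi (n - 1) = z powi n * z powi (- 1)"
      using powi_add_circle[OF that, of n "-1"] powi_add_circle[OF that, of n 1] by simp_all
    ultimately show ?thesis by (simp only: ring_distribs mult_ac)
  qed
  have "integrable circle_measure (\<lambda>z. of_real (p z) * f z * z powi n)" for n :: int
    by (subst Bochner_Integration.integrable_cong[OF refl pz])
       (auto intro!: integrable_mult_powi linear)
  from this[of 0] have "integrable circle_measure (\<lambda>z. of_real (p z) * f z)" by simp
  moreover have "(\<integral>z. of_real (p z) * f z * z powi n \<partial>circle_measure) = 0" for n :: int
    by (subst Bochner_Integration.integral_cong[OF refl pz])
       (simp_all add: integrable_mult_powi linear)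
  ultimately show ?case by blast
next
  case (const c)
  then show ?case by (simp add: mult.assoc)
next
  case (add p q)
  from add.IH(1)[OF add.prems] add.IH(2)[OF add.prems] show ?case
    by (simp add: distrib_right integrable_mult_powi)
next
  \<comment> \<open>The induction hypothesis for \<open>p\<close> is used with \<open>q * f\<close>
    in place of \<open>f\<close>; this is why \<open>f\<close> is generalized.\<close>
  case (mult p q)
  from mult.IH(2)[OF mult.prems] have "integrable circle_measure (\<lambda>z. of_real (q z) * f z)"
    "\<And>n::int. (\<integral>z. of_real (q z) * f z * z powi n \<partial>circle_measure) = 0" by auto
  from mult.IH(1)[OF this] show ?case by (simp add: mult.assoc)
qed

text \<open>Stone-Weierstrass approximates \<phi> uniformly on the circle by real polynomials, for
  which the integral vanishes by the previous lemma; the error is at most the uniform distance times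
  the L1 norm of \<open>f\<close>.\<close>

lemma fourier_zero_integral_continuous:
  fixes \<phi> :: "complex \<Rightarrow> real"
  assumes f: "integrable circle_measure f"
    and zero: "\<And>n::int. (\<integral>z. f z * z powi n \<partial>circle_measure) = 0"
    and \<phi>: "continuous_on (sphere 0 1) \<phi>"
  shows "(\<integral>z. of_real (\<phi> z) * f z \<partial>circle_measure) = 0"
proof -
  let ?I = "\<integral>z. of_real (\<phi> z) * f z \<partial>circle_measure"
  have "compact (\<phi> ` sphere 0 1)" using \<phi> by (rule compact_continuous_image) simp
  then obtain C where "\<forall>y\<in>\<phi> ` sphere 0 1. norm y \<le> C"
    by (meson compact_imp_bounded bounded_iff)
  then have C: "\<bar>\<phi> z\<bar> \<le> C" if "z \<in> sphere 0 1" for z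
    using that by (metis imageI real_norm_def)
  have m [measurable]: "\<phi> \<in> borel_measurable circle_measure" by (rule measurable_circle_continuous[OF \<phi>])
  have int: "integrable circle_measure (\<lambda>z. of_real (\<phi> z) * f z)"
    by (rule integrable_mult_bounded[OF f, of _ C]) (use C in auto)
  have "cmod ?I \<le> e" if "0 < e" for e
  proof -
    \<comment> \<open>The summand 1 keeps the divisor of \<open>e\<close> positive even if
      \<open>f\<close> vanishes almost everywhere.\<close>
    define K where "K = (\<integral>z. cmod (f z) \<partial>circle_measure) + 1"
    have K: "K > 0" by (simp add: K_def add_nonneg_pos)
    obtain g where g: "real_polynomial_function g" "\<And>z. z \<in> sphere 0 1 \<Longrightarrow> \<bar>\<phi> z - g z\<bar> < e / K"
      by (rule Stone_Weierstrass_real_polynomial_function[OF compact_sphere \<phi>, of "e / K"])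
        (use \<open>0 < e\<close> K in auto)
    note gz = fourier_zero_mult_polynomial[OF g(1) f zero]
    then have gi: "integrable circle_measure (\<lambda>z. of_real (g z) * f z)" by blast
    have "(\<integral>z. of_real (g z) * f z * z powi 0 \<partial>circle_measure) = 0" using gz by blast
    then have g0: "(\<integral>z. of_real (g z) * f z \<partial>circle_measure) = 0" by simp
    have "?I = (\<integral>z. of_real (\<phi> z) * f z - of_real (g z) * f z \<partial>circle_measure)"
      using int gi g0 by simp
    also have "cmod \<dots> \<le> (\<integral>z. e / K * cmod (f z) \<partial>circle_measure)"
    proof (rule order_trans[OF integral_norm_bound integral_mono])
      fix z assume "z \<in> space circle_measure"
      then have "\<bar>\<phi> z - g z\<bar> \<le> e / K" using g(2) by force
      then have "\<bar>\<phi> z - g z\<bar> * cmod (f z) \<le> e / K * cmod (f z)" by (intro mult_right_mono) auto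
      then show "norm (of_real (\<phi> z) * f z - of_real (g z) * f z) \<le> e / K * cmod (f z)"
        by (simp add: norm_mult flip: left_diff_distrib of_real_diff)
    qed (use int gi f in auto)
    also have "\<dots> = e / K * (K - 1)" by (simp add: K_def)
    also have "\<dots> \<le> e" using K that by (simp add: field_simps)
    finally show ?thesis .
  qed
  then have "cmod ?I \<le> 0" by (rule dense_ge)
  then show ?thesis by simp
qed

lemma fourier_zero_integral_closed:
  assumes f: "integrable circle_measure f"
    and zero: "\<And>n::int. (\<integral>z. f z * z powi n \<partial>circle_measure) = 0"
    and C: "closed C" "C \<noteq> {}"
  shows "(\<integral>z. of_real (indicator C z) * f z \<partial>circle_measure) = 0"
proof -
  \<comment> \<open>Continuous tents of height 1 on \<open>C\<close> that shrink to its indicator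
    and stay in [0, 1], so \<open>cmod (f z)\<close> dominates. A nonempty \<open>C\<close> is
    essential: \<open>infdist\<close> to the empty set is 0, and the tents would be constantly
    1.\<close>
  define \<phi> where "\<phi> k z = max 0 (1 - real k * infdist z C)" for k :: nat and z :: complex
  have \<phi>_cont: "continuous_on (sphere 0 1) (\<phi> k)" for k
    unfolding \<phi>_def[abs_def] by (intro continuous_intros)
  have [measurable]: "\<phi> k \<in> borel_measurable circle_measure" for k
    by (rule measurable_circle_continuous[OF \<phi>_cont])
  have lim: "(\<lambda>k. \<phi> k z) \<longlonglongrightarrow> indicator C z" for z
  proof (cases "z \<in> C")
    case True
    then show ?thesis by (simp add: \<phi>_def)
  next
    case False
    then have d: "infdist z C > 0"
      using in_closed_iff_infdist_zero[OF C, of z] infdist_nonneg[of z C] by linarith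
    have "\<forall>\<^sub>F k in sequentially. \<phi> k z = 0"
      using eventually_ge_at_top[of "nat \<lceil>1 / infdist z C\<rceil>"]
    proof eventually_elim
      case (elim k)
      then have "1 / infdist z C \<le> real k" by linarith
      then show ?case using d by (simp add: \<phi>_def field_simps)
    qed
    then show ?thesis using False by (simp add: tendsto_eventually)
  qed
  have "(\<lambda>k. \<integral>z. of_real (\<phi> k z) * f z \<partial>circle_measure) \<longlonglongrightarrow> (\<integral>z. of_real (indicator C z) * f z \<partial>circle_measure)"
  proof (rule integral_dominated_convergence[where w = "\<lambda>z. cmod (f z)"])
    have "indicat_real C \<in> borel_measurable circle_measure"
      by (rule borel_measurable_LIMSEQ_real[OF lim]) auto
    then show "(\<lambda>z. of_real (indicator C z) * f z) \<in> borel_measurable circle_measure" using f by measurable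
    show "AE z in circle_measure. (\<lambda>k. of_real (\<phi> k z) * f z) \<longlonglongrightarrow> of_real (indicator C z) * f z"
      by (intro AE_I2 tendsto_intros lim)
    have "\<bar>\<phi> k z\<bar> \<le> 1" for k z by (simp add: \<phi>_def infdist_nonneg)
    then show "AE z in circle_measure. norm (of_real (\<phi> k z) * f z) \<le> cmod (f z)" for k
      by (simp add: norm_mult mult_left_le_one_le)
  qed (use f in auto)
  moreover have "(\<integral>z. of_real (\<phi> k z) * f z \<partial>circle_measure) = 0" for k
    by (rule fourier_zero_integral_continuous[OF f zero \<phi>_cont])
  ultimately show ?thesis by (simp add: LIMSEQ_const_iff)
qed

text \<open>Borel sets are generated from closed intervals by complements and countable disjoint
  unions. The total integral handles complements and countable additivity the unions, so the
  integral vanishes over every Borel set.\<close>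

lemma integral_intervals_zero_imp_AE_zero:
  fixes h :: "real \<Rightarrow> complex"
  assumes h: "integrable lborel h" and total: "(LINT t|lborel. h t) = 0"
    and zero: "\<And>a b. (LINT t:{a..b}|lborel. h t) = 0"
  shows "AE t in lborel. h t = 0"
proof (rule sigma_finite_measure.density_zero[OF sigma_finite_lborel h])
  fix A :: "real set" assume "A \<in> sets lborel"
  then have "A \<in> sets borel" by simp
  then show "(LINT t:A|lborel. h t) = 0"
  proof (induction rule: borel_set_induct)
    case empty
    then show ?case by (simp add: set_lebesgue_integral_def)
  next
    case (interval a b)
    show ?case by (rule zero)
  next
    case (compl A)
    then have A: "A \<in> sets lborel" by simp
    have "(LINT t:-A|lborel. h t) = (LINT t|lborel. h t - indicator A t *\<^sub>R h t)"
      unfolding set_lebesgue_integral_def by (rule Bochner_Integration.integral_cong) (auto split: split_indicator)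
    also have "\<dots> = (LINT t|lborel. h t) - (LINT t:A|lborel. h t)"
      unfolding set_lebesgue_integral_def
      by (rule Bochner_Integration.integral_diff[OF h integrable_mult_indicator[OF A h]])
    finally show ?case using compl total by simp
  next
    case (union A)
    have "set_integrable lborel (\<Union>i. A i) h"
      unfolding set_integrable_def by (rule integrable_mult_indicator[OF _ h]) (use union in auto)
    then show ?case
      using union by (subst lebesgue_integral_countable_add) (auto simp: disjoint_family_on_def)
  qed
qed

text \<open>Closed subintervals of the parameter range map to closed arcs, over which the integral
  vanishes. Transported back to the line, this says that all interval integrals of the extension
  \<open>h\<close> by zero vanish.\<close>

theorem fourier_unique:
  assumes f: "integrable circle_measure f"
    and zero: "\<And>n::int. (\<integral>z. f z * z powi n \<partial>circle_measure) = 0"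
  shows "AE z in circle_measure. f z = 0"
proof -
  define h where "h t = indicator {0..2*pi} t *\<^sub>R f (cis t)" for t
  have h: "integrable lborel h"
    using f unfolding integrable_circle_iff set_integrable_def h_def[abs_def] .
  have total: "(LINT t|lborel. h t) = 0"
    using zero[of 0] by (simp add: integral_circle set_lebesgue_integral_def h_def)
  have "(LINT t:{a..b}|lborel. h t) = 0" for a b
  \<comment> \<open>An empty intersection would produce an empty arc, which
    \<open>fourier_zero_integral_closed\<close> excludes.\<close>
  proof (cases "{a..b} \<inter> {0..2*pi} = {}")
    case True
    then have "indicator {a..b} t *\<^sub>R h t = 0" for t by (auto simp: h_def split: split_indicator)
    then show ?thesis unfolding set_lebesgue_integral_def by (simp only: Bochner_Integration.integral_zero)
  next
    case False
    define C where "C = cis ` ({a..b} \<inter> {0..2*pi})"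
    have "compact C" unfolding C_def by (intro compact_continuous_image continuous_intros compact_Int) auto
    then have C: "closed C" "C \<noteq> {}" using False by (simp_all add: C_def compact_imp_closed)
    \<comment> \<open>The endpoints 0 and \<open>2*pi\<close> are glued together by
      \<open>cis\<close>, so an interval containing just one of them has an arc that also catches
      the other. The claim is therefore limited to interior parameters, and the two endpoints are
      discarded as null sets below.\<close>
    have ind: "indicator C (cis t) = indicat_real {a..b} t" if t: "0 < t" "t < 2*pi" for t
    proof -
      have "t = s" if s: "cis t = cis s" "0 \<le> s" "s \<le> 2*pi" for s
      proof -
        have tt: "Arg2pi (cis t) = t" using t by (simp add: cis_conv_exp Arg2pi_exp)
        show ?thesis
        proof (cases "s = 2*pi")
          case True
          then have "cis t = cis 0" using s by simp
          moreover have "Arg2pi (cis 0) = 0" using Arg2pi_of_real[of 1] by simp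
          ultimately have "t = 0" using tt by metis
          then show ?thesis using t by simp
        next
          case False
          then have "Arg2pi (cis s) = s" using s by (simp add: cis_conv_exp Arg2pi_exp)
          then show ?thesis using tt s(1) by metis
        qed
      qed
      then have "t \<in> {a..b}" if "s \<in> {a..b} \<inter> {0..2*pi}" "cis t = cis s" for s
        using that by (metis IntE atLeastAtMost_iff)
      then have "cis t \<in> C \<longleftrightarrow> t \<in> {a..b}"
        unfolding C_def image_iff using t by (metis IntI atLeastAtMost_iff less_imp_le)
      then show ?thesis by (simp only: indicator_def)
    qed
    have "(LINT t:{0..2*pi}|lborel. of_real (indicator C (cis t)) * f (cis t)) = 0"
      using fourier_zero_integral_closed[OF f zero C] unfolding integral_circle scaleR_eq_0_iff by auto
    moreover have "(LINT t:{0..2*pi}|lborel. of_real (indicator C (cis t)) * f (cis t)) = (LINT t:{a..b}|lborel. h t)"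
      unfolding set_lebesgue_integral_def
    proof (rule integral_cong_AE)
      have "integrable circle_measure (\<lambda>z. complex_of_real (indicator C z) * f z)"
      proof (rule integrable_mult_bounded[OF f])
        have "indicat_real C \<in> borel_measurable borel" using C by simp
        then have "indicat_real C \<in> borel_measurable circle_measure"
          using measurable_compose[OF borel_measurable_ident_circle] by blast
        then show "(\<lambda>z. complex_of_real (indicator C z)) \<in> borel_measurable circle_measure" by measurable
        show "cmod (complex_of_real (indicator C z)) \<le> 1" for z by (simp add: indicator_def)
      qed
      then show "(\<lambda>t. indicator {0..2*pi} t *\<^sub>R (complex_of_real (indicator C (cis t)) * f (cis t))) \<in> borel_measurable lborel"
        unfolding integrable_circle_iff set_integrable_def by (rule borel_measurable_integrable)
      have [measurable]: "h \<in> borel_measurable lborel" using h by (rule borel_measurable_integrable)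
      show "(\<lambda>t. indicator {a..b} t *\<^sub>R h t) \<in> borel_measurable lborel" by measurable
      show "AE t in lborel. indicator {0..2*pi} t *\<^sub>R (complex_of_real (indicator C (cis t)) * f (cis t))
          = indicator {a..b} t *\<^sub>R h t"
        using AE_lborel_singleton[of 0] AE_lborel_singleton[of "2*pi"]
      proof eventually_elim
        case (elim t)
        show ?case
        proof (cases "t \<in> {0..2*pi}")
          case True
          then show ?thesis using ind[of t] elim by (simp add: h_def split: split_indicator)
        next
          case False
          then show ?thesis by (simp add: h_def)
        qed
      qed
    qed
    ultimately show ?thesis by simp
  qed
  then have "AE t in lborel. h t = 0" by (rule integral_intervals_zero_imp_AE_zero[OF h total])
  then have "AE t in lborel. t \<in> {0..2*pi} \<longrightarrow> f (cis t) = 0"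
  proof eventually_elim
    case (elim t)
    then show ?case by (cases "t \<in> {0..2*pi}") (auto simp: h_def)
  qed
  moreover have "{z \<in> sphere 0 1. f z = 0} \<in> sets circle_measure"
  proof -
    have [measurable]: "f \<in> borel_measurable circle_measure" using f by simp
    have "{z \<in> space circle_measure. f z = 0} \<in> sets circle_measure" by measurable
    then show ?thesis by simp
  qed
  ultimately show ?thesis by (subst AE_circle_iff)
qed

section \<open>The Hardy space and the model space\<close>

text \<open>Powers of z stay in the form \<open>powi\<close> even for natural exponents, so that
  nonnegative and negative frequencies fall under the same lemmas.\<close>

declare power_int_of_nat [simp del] complex_cnj_power_int [simp del]

lemma in_L2_iff: "in_L2 F \<longleftrightarrow> sq_integrable circle_measure F"
  by (simp add: in_L2_def sq_integrable_def measurable_circle_iff_set integrable_circle_iff)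

lemma fourier_eq: "fourier F n = l2_inner circle_measure F (\<lambda>z. z powi n)"
  by (simp add: fourier_def circ_int_eq l2_inner_def complex_cnj_power_int)

lemma ip_eq: "ip f g = l2_inner circle_measure f g"
  by (simp add: ip_def circ_int_eq l2_inner_def)

lemma H2_iff:
  "H2 F \<longleftrightarrow> sq_integrable circle_measure F \<and>
    (\<forall>n<0. l2_inner circle_measure F (\<lambda>z. z powi n) = 0)"
  by (auto simp: H2_def in_L2_iff fourier_eq)

lemma l2_inner_circle_cong:
  assumes "\<And>z. cmod z = 1 \<Longrightarrow> f z * cnj (g z) = f' z * cnj (g' z)"
  shows "l2_inner circle_measure f g = l2_inner circle_measure f' g'"
  unfolding l2_inner_def by (rule Bochner_Integration.integral_cong) (use assms in auto)

lemma sq_integrable_powi_mult: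
  assumes "sq_integrable circle_measure f"
  shows "sq_integrable circle_measure (\<lambda>z. z powi n * f z)"
proof (rule sq_integrable_mult_bounded[OF assms borel_measurable_powi_circle])
  show "AE z in circle_measure. cmod (z powi n) \<le> 1"
    by (rule AE_I2) (simp add: norm_powi_circle)
qed

lemma sq_integrable_powi: "sq_integrable circle_measure (\<lambda>z. z powi n)"
proof -
  have "sq_integrable circle_measure (\<lambda>z. 1)"
    by (simp add: sq_integrable_def finite_measure.integrable_const[OF finite_measure_circle])
  from sq_integrable_powi_mult[OF this, of n] show ?thesis by simp
qed

lemma integral_powi_circle: "(\<integral>z. z powi n \<partial>circle_measure) = (if n = 0 then 1 else 0)"
proof (cases "n = 0")
  case True
  have "measure circle_measure (space circle_measure) = 1"
    using prob_circle by (simp add: measure_def)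
  with True show ?thesis by simp
next
  case False
  have "(LINT t:{0..2*pi}|lborel. cis (of_int n * t))
      = cis (of_int n * (2*pi)) / (\<i> * of_int n) - cis (of_int n * 0) / (\<i> * of_int n)"
    unfolding set_lebesgue_integral_def
  proof (rule integral_FTC_Icc)
    show "((\<lambda>t. cis (of_int n * t) / (\<i> * of_int n)) has_vector_derivative cis (of_int n * t))
        (at t within {0..2*pi})" for t
      unfolding cis_conv_exp using False
      by (auto intro!: derivative_eq_intros has_vector_derivative_real_field simp: divide_simps) (simp add: mult_ac)
    show "continuous_on {0..2*pi} (\<lambda>t. cis (of_int n * t))" by (intro continuous_intros)
  qed simp
  also have "\<dots> = 0" using cis_multiple_2pi[of "of_int n"] by (simp add: mult.commute)
  finally show ?thesis using False by (simp add: integral_circle cis_power_int)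
qed

lemma l2_inner_powi:
  "l2_inner circle_measure (\<lambda>z. z powi n) (\<lambda>z. z powi m) = (if n = m then 1 else 0)"
proof -
  have "l2_inner circle_measure (\<lambda>z. z powi n) (\<lambda>z. z powi m) = (\<integral>z. z powi (n - m) \<partial>circle_measure)"
    unfolding l2_inner_def
  proof (rule Bochner_Integration.integral_cong[OF refl])
    fix z assume "z \<in> space circle_measure"
    then have "cmod z = 1" by simp
    then show "z powi n * cnj (z powi m) = z powi (n - m)"
      by (simp only: cnj_powi_circle diff_conv_add_uminus powi_add_circle)
  qed
  then show ?thesis by (simp add: integral_powi_circle)
qed

lemma l2_inner_powi_shift:
  "l2_inner circle_measure (\<lambda>z. z powi n * f z) g = l2_inner circle_measure f (\<lambda>z. z powi (- n) * g z)"
  by (rule l2_inner_circle_cong) (simp add: cnj_powi_circle)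

lemma fourier_unique_sq:
  assumes g: "sq_integrable circle_measure g"
    and "\<And>n. l2_inner circle_measure g (\<lambda>z. z powi n) = 0"
  shows "AE z in circle_measure. g z = 0"
proof (rule fourier_unique)
  show "integrable circle_measure g"
    by (rule finite_measure.integrable_sq_integrable[OF finite_measure_circle g])
  show "(\<integral>z. g z * z powi n \<partial>circle_measure) = 0" for n
  proof -
    have "(\<integral>z. g z * z powi n \<partial>circle_measure) = l2_inner circle_measure g (\<lambda>z. z powi (- n))"
      unfolding l2_inner_def
      by (rule Bochner_Integration.integral_cong[OF refl]) (simp add: cnj_powi_circle)
    then show ?thesis using assms(2) by simp
  qed
qed

text \<open>Here \<open>U\<close> consists of the negative powers of z. Membership in H2 is
  orthogonality to \<open>U\<close>, and completeness relative to \<open>U\<close> becomes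
  uniqueness of Fourier coefficients over all integers.\<close>

lemma H2_parseval:
  assumes F: "H2 F"
  shows "(\<lambda>N. l2_sq circle_measure (\<lambda>z. (\<Sum>k<N. fourier F (int k) * z powi int k) - F z)) \<longlonglongrightarrow> 0"
    and "(\<lambda>k. (cmod (fourier F (int k)))\<^sup>2) sums l2_sq circle_measure F"
proof -
  let ?U = "(\<lambda>n::int. \<lambda>z::complex. z powi n) ` {..<0}"
  have F': "sq_integrable circle_measure F" "\<And>n. n < 0 \<Longrightarrow> l2_inner circle_measure F (\<lambda>z. z powi n) = 0"
    using F by (auto simp: H2_iff)
  have e: "orthonormal_system circle_measure UNIV (\<lambda>k z. z powi int k)"
    by (simp add: orthonormal_system_def sq_integrable_powi l2_inner_powi)
  have complete: "AE z in circle_measure. g z = 0"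
    if g: "sq_integrable circle_measure g" "\<And>u. u \<in> ?U \<Longrightarrow> l2_inner circle_measure g u = 0"
      "\<And>k. k \<in> UNIV \<Longrightarrow> l2_inner circle_measure g (\<lambda>z. z powi int k) = 0" for g
  proof (rule fourier_unique_sq[OF g(1)])
    fix n :: int
    show "l2_inner circle_measure g (\<lambda>z. z powi n) = 0"
    proof (cases "n < 0")
      case True
      then show ?thesis by (intro g(2)) auto
    next
      case False
      then show ?thesis using g(3)[of "nat n"] by simp
    qed
  qed
  have U: "\<And>u. u \<in> ?U \<Longrightarrow> sq_integrable circle_measure u"
      "\<And>u. u \<in> ?U \<Longrightarrow> l2_inner circle_measure F u = 0"
      "\<And>u k. u \<in> ?U \<Longrightarrow> k \<in> UNIV \<Longrightarrow> l2_inner circle_measure (\<lambda>z. z powi int k) u = 0"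
    using F' by (auto simp: sq_integrable_powi l2_inner_powi)
  have p: "(\<lambda>N. l2_sq circle_measure (\<lambda>z. (\<Sum>i\<in>UNIV \<inter> {..<N}. l2_inner circle_measure F (\<lambda>z. z powi int i)
        * z powi int i) - F z)) \<longlonglongrightarrow> 0"
      "(\<lambda>n. if n \<in> UNIV then (cmod (l2_inner circle_measure F (\<lambda>z. z powi int n)))\<^sup>2 else 0)
        sums l2_sq circle_measure F"
    by (rule finite_measure.parseval[OF finite_measure_circle e F'(1), where U = ?U], fact U, fact U, fact U, fact complete)+
  from p(1) show "(\<lambda>N. l2_sq circle_measure (\<lambda>z. (\<Sum>k<N. fourier F (int k) * z powi int k) - F z)) \<longlonglongrightarrow> 0"
    by (simp add: fourier_eq)
  from p(2) show "(\<lambda>k. (cmod (fourier F (int k)))\<^sup>2) sums l2_sq circle_measure F"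
    by (simp add: fourier_eq)
qed

text \<open>The integral of \<open>z * F * G\<close> vanishes. The product is only integrable, so
  \<open>F\<close> is replaced by its Taylor polynomials, which converge in L2; against a monomial
  the integral is a coefficient of \<open>G\<close> of negative index.\<close>

lemma H2_mult_mean_zero:
  assumes F: "H2 F" and G: "H2 G"
  shows "l2_inner circle_measure F (\<lambda>z. cnj (z * G z)) = 0"
proof -
  let ?h = "\<lambda>z. cnj (z * G z)"
  have F': "sq_integrable circle_measure F" and G': "sq_integrable circle_measure G"
    using F G by (auto simp: H2_iff)
  have h: "sq_integrable circle_measure ?h"
    using sq_integrable_cnj[OF sq_integrable_powi_mult[OF G', of 1]] by simp
  have "l2_inner circle_measure (\<lambda>z. z powi int k) ?h = 0" for k
  proof -
    have "l2_inner circle_measure (\<lambda>z. z powi int k) ?h = l2_inner circle_measure G (\<lambda>z. z powi (- (int k + 1)))"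
      by (rule l2_inner_circle_cong)
        (simp only: cnj_powi_circle minus_minus powi_add_circle power_int_1_right complex_cnj_cnj mult_ac)
    then show ?thesis using G by (simp add: H2_iff)
  qed
  then have "l2_inner circle_measure (\<lambda>z. \<Sum>k<N. fourier F (int k) * z powi int k) ?h = 0" for N
    by (subst l2_inner_sum_left) (simp_all add: sq_integrable_cmult sq_integrable_powi l2_inner_cmult_left h[simplified])
  moreover have "(\<lambda>N. l2_inner circle_measure (\<lambda>z. \<Sum>k<N. fourier F (int k) * z powi int k) ?h)
      \<longlonglongrightarrow> l2_inner circle_measure F ?h"
    by (rule l2_inner_tendsto[OF _ F' h H2_parseval(1)[OF F]])
      (intro sq_integrable_sum sq_integrable_cmult sq_integrable_powi)
  ultimately show ?thesis by (simp add: LIMSEQ_const_iff)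
qed

text \<open>\<open>G\<close> is the backward shift of \<open>F\<close>, iterated \<open>J\<close>
  times. It moves the inner product with \<open>F\<close> from \<open>z powi int J * u\<close> to
  \<open>u\<close>, so tails of the coefficients of \<open>F\<close> become full H2 norms.\<close>

lemma H2_shift:
  assumes F: "H2 F"
  obtains G where "H2 G" "\<And>k. fourier G (int k) = fourier F (int (k + J))"
    "\<And>u. H2 u \<Longrightarrow> l2_inner circle_measure G u = l2_inner circle_measure F (\<lambda>z. z powi int J * u z)"
proof -
  let ?C = circle_measure
  define p where "p z = (\<Sum>k<J. fourier F (int k) * z powi int k)" for z
  define G where "G z = z powi (- int J) * (F z - p z)" for z
  have F': "sq_integrable ?C F" using F by (simp add: H2_iff)
  have p: "sq_integrable ?C p"
    unfolding p_def[abs_def] by (intro sq_integrable_sum sq_integrable_cmult sq_integrable_powi)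
  have G_sq: "sq_integrable ?C G"
    unfolding G_def[abs_def] by (rule sq_integrable_powi_mult[OF sq_integrable_diff[OF F' p]])
  have G_inner: "l2_inner ?C G u = l2_inner ?C F (\<lambda>z. z powi int J * u z)
      - (\<Sum>k<J. fourier F (int k) * l2_inner ?C (\<lambda>z. z powi int k) (\<lambda>z. z powi int J * u z))"
    if u: "sq_integrable ?C u" for u
  proof -
    have zu: "sq_integrable ?C (\<lambda>z. z powi int J * u z)" by (rule sq_integrable_powi_mult[OF u])
    have "l2_inner ?C G u = l2_inner ?C F (\<lambda>z. z powi int J * u z) - l2_inner ?C p (\<lambda>z. z powi int J * u z)"
      unfolding G_def[abs_def] l2_inner_powi_shift minus_minus by (rule l2_inner_diff_left[OF F' p zu])
    also have "l2_inner ?C p (\<lambda>z. z powi int J * u z)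
        = (\<Sum>k<J. fourier F (int k) * l2_inner ?C (\<lambda>z. z powi int k) (\<lambda>z. z powi int J * u z))"
      unfolding p_def[abs_def]
      by (subst l2_inner_sum_left) (simp_all add: sq_integrable_cmult sq_integrable_powi l2_inner_cmult_left zu)
    finally show ?thesis .
  qed
  have coeff: "l2_inner ?C G (\<lambda>z. z powi n) = (if n < 0 then 0 else fourier F (int J + n))" for n
  proof -
    have eq: "l2_inner ?C f (\<lambda>z. z powi int J * z powi n) = l2_inner ?C f (\<lambda>z. z powi (int J + n))" for f
      by (rule l2_inner_circle_cong) (simp only: powi_add_circle)
    have "l2_inner ?C G (\<lambda>z. z powi n) = fourier F (int J + n)
        - (\<Sum>k<J. if int k = int J + n then fourier F (int k) else 0)"
      unfolding G_inner[OF sq_integrable_powi] eq l2_inner_powi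
      by (simp add: fourier_eq if_distrib cong: if_cong)
    also have "(\<Sum>k<J. if int k = int J + n then fourier F (int k) else 0)
        = (if n < 0 then fourier F (int J + n) else 0)"
    \<comment> \<open>Coefficients with index from \<open>- int J\<close> to -1 cancel against the
      removed Taylor polynomial; those further down vanish because \<open>F\<close> is in
      H2.\<close>
    proof (cases "n < 0 \<and> 0 \<le> int J + n")
      case True
      then have "(\<Sum>k<J. if int k = int J + n then fourier F (int k) else 0)
          = (\<Sum>k<J. if k = nat (int J + n) then fourier F (int J + n) else 0)"
        by (intro sum.cong) auto
      with True show ?thesis by (simp add: nat_less_iff)
    next
      case False
      then have "(\<Sum>k<J. if int k = int J + n then fourier F (int k) else 0) = 0"
        by (intro sum.neutral) auto
      moreover have "fourier F (int J + n) = 0" if "n < 0"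
        using False that F by (simp add: H2_def)
      ultimately show ?thesis by simp
    qed
    finally show ?thesis by simp
  qed
  show thesis
  proof
    show "H2 G" using G_sq coeff by (simp add: H2_iff)
    show "fourier G (int k) = fourier F (int (k + J))" for k
      using coeff[of "int k"] by (simp add: fourier_eq add.commute)
    show "l2_inner ?C G u = l2_inner ?C F (\<lambda>z. z powi int J * u z)" if u: "H2 u" for u
    proof -
      \<comment> \<open>The removed polynomial has degree below \<open>J\<close> and is orthogonal
        to \<open>z powi int J * u\<close>: the inner products are coefficients of \<open>u\<close>
        of index \<open>int k - int J < 0\<close>.\<close>
      have "l2_inner ?C (\<lambda>z. z powi int k) (\<lambda>z. z powi int J * u z) = 0" if k: "k < J" for k
      proof -
        have "l2_inner ?C (\<lambda>z. z powi int J * u z) (\<lambda>z. z powi int k) = l2_inner ?C u (\<lambda>z. z powi (int k - int J))"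
          unfolding l2_inner_powi_shift
          by (rule l2_inner_circle_cong) (simp only: powi_add_circle[symmetric], simp add: algebra_simps)
        also have "\<dots> = 0" using u k by (simp add: H2_iff)
        finally show ?thesis by (subst l2_inner_commute) simp
      qed
      then show ?thesis using G_inner[of u] u by (simp add: H2_iff)
    qed
  qed
qed

section \<open>Inner functions and the conjugation of the model space\<close>

lemma inner_fun_circle:
  assumes "inner_fun \<theta>"
  shows "\<theta> \<in> borel_measurable circle_measure" "AE z in circle_measure. cmod (\<theta> z) = 1" "H2 \<theta>"
proof -
  let ?C = circle_measure
  show m [measurable]: "\<theta> \<in> borel_measurable ?C"
    using assms by (simp add: inner_fun_def Hinf_def measurable_circle_iff_set)
  have "{z \<in> space ?C. cmod (\<theta> z) = 1} \<in> sets ?C" by measurable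
  then show ae: "AE z in ?C. cmod (\<theta> z) = 1"
    using assms by (subst AE_circle_iff) (simp_all add: inner_fun_def)
  have "sq_integrable ?C (\<lambda>z. \<theta> z * z powi 0)"
  proof (rule sq_integrable_mult_bounded[OF sq_integrable_powi m])
    show "AE z in ?C. cmod (\<theta> z) \<le> 1" using ae by eventually_elim simp
  qed
  then show "H2 \<theta>" using assms by (simp add: H2_def in_L2_iff inner_fun_def Hinf_def)
qed

lemma sq_integrable_inner_mult:
  assumes "inner_fun \<theta>" "sq_integrable circle_measure f"
  shows "sq_integrable circle_measure (\<lambda>z. \<theta> z * f z)"
proof (rule sq_integrable_mult_bounded[OF assms(2) inner_fun_circle(1)[OF assms(1)]])
  show "AE z in circle_measure. cmod (\<theta> z) \<le> 1"
    using inner_fun_circle(2)[OF assms(1)] by eventually_elim simp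
qed

lemma l2_inner_inner_mult:
  assumes \<theta>: "inner_fun \<theta>" and f: "sq_integrable circle_measure f" and g: "sq_integrable circle_measure g"
  shows "l2_inner circle_measure (\<lambda>z. \<theta> z * f z) (\<lambda>z. \<theta> z * g z) = l2_inner circle_measure f g"
  unfolding l2_inner_def
proof (rule integral_cong_AE)
  show "(\<lambda>z. \<theta> z * f z * cnj (\<theta> z * g z)) \<in> borel_measurable circle_measure"
    "(\<lambda>z. f z * cnj (g z)) \<in> borel_measurable circle_measure"
    using inner_fun_circle(1)[OF \<theta>] f g by (auto simp: sq_integrable_def)
  show "AE z in circle_measure. \<theta> z * f z * cnj (\<theta> z * g z) = f z * cnj (g z)"
    using inner_fun_circle(2)[OF \<theta>]
  proof eventually_elim
    case (elim z)
    then have "\<theta> z * cnj (\<theta> z) = 1" by (simp flip: complex_norm_square)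
    then show ?case by (simp add: mult_ac)
  qed
qed

lemma H2_inner_powi:
  assumes "inner_fun \<theta>"
  shows "H2 (\<lambda>z. \<theta> z * z powi int m)"
  unfolding H2_iff
proof (intro conjI allI impI)
  show "sq_integrable circle_measure (\<lambda>z. \<theta> z * z powi int m)"
    by (rule sq_integrable_inner_mult[OF assms sq_integrable_powi])
  fix n :: int assume "n < 0"
  have "l2_inner circle_measure (\<lambda>z. \<theta> z * z powi int m) (\<lambda>z. z powi n)
      = l2_inner circle_measure \<theta> (\<lambda>z. z powi (n - int m))"
    by (rule l2_inner_circle_cong)
      (simp only: cnj_powi_circle, simp only: powi_add_circle[symmetric] mult.assoc, simp add: algebra_simps)
  also have "\<dots> = 0" using inner_fun_circle(3)[OF assms] \<open>n < 0\<close> by (simp add: H2_iff)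
  finally show "l2_inner circle_measure (\<lambda>z. \<theta> z * z powi int m) (\<lambda>z. z powi n) = 0" .
qed

text \<open>The factor \<theta> is kept in front of a bracketed product so that
  \<open>l2_inner_inner_mult\<close> can cancel it.\<close>

definition model_conj :: "(complex \<Rightarrow> complex) \<Rightarrow> (complex \<Rightarrow> complex) \<Rightarrow> complex \<Rightarrow> complex" where
  "model_conj \<theta> f z = \<theta> z * (cnj z * cnj (f z))"

lemma sq_integrable_cnj_mult:
  assumes "sq_integrable circle_measure f"
  shows "sq_integrable circle_measure (\<lambda>z. cnj z * cnj (f z))"
  using sq_integrable_cnj[OF sq_integrable_powi_mult[OF assms, of 1]] by simp

lemma sq_integrable_model_conj:
  "inner_fun \<theta> \<Longrightarrow> sq_integrable circle_measure f \<Longrightarrow> sq_integrable circle_measure (model_conj \<theta> f)"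
  unfolding model_conj_def[abs_def] by (intro sq_integrable_inner_mult sq_integrable_cnj_mult)

text \<open>Both sides integrate \<theta> against the conjugate of \<open>z * f * g\<close>, which
  is symmetric in f and g. This trades orthogonality of f to the conjugate of \<open>g n\<close> for
  orthogonality of the conjugate of f to \<open>g n\<close>.\<close>

lemma l2_inner_model_conj_swap:
  "l2_inner circle_measure (model_conj \<theta> f) g = l2_inner circle_measure (model_conj \<theta> g) f"
  by (rule l2_inner_circle_cong) (simp add: model_conj_def mult_ac)

lemma l2_inner_model_conj_conj:
  assumes "inner_fun \<theta>" "sq_integrable circle_measure f" "sq_integrable circle_measure g"
  shows "l2_inner circle_measure (model_conj \<theta> f) (model_conj \<theta> g) = l2_inner circle_measure g f"
proof -
  have "l2_inner circle_measure (model_conj \<theta> f) (model_conj \<theta> g)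
      = l2_inner circle_measure (\<lambda>z. cnj z * cnj (f z)) (\<lambda>z. cnj z * cnj (g z))"
    unfolding model_conj_def[abs_def]
    using assms by (intro l2_inner_inner_mult sq_integrable_cnj_mult)
  also have "\<dots> = l2_inner circle_measure g f"
  proof (rule l2_inner_circle_cong)
    fix z :: complex assume "cmod z = 1"
    then have "z * cnj z = 1" by (simp flip: complex_norm_square)
    then show "cnj z * cnj (f z) * cnj (cnj z * cnj (g z)) = g z * cnj (f z)"
      by (simp add: mult_ac)
  qed
  finally show ?thesis .
qed

text \<open>As n runs through the negative integers, \<open>- n - 1\<close> runs through the natural
  numbers. Hence analyticity of the conjugate amounts to orthogonality of f to every
  \<open>\<theta> * z ^ m\<close>.\<close>

lemma l2_inner_model_conj_powi:
  "l2_inner circle_measure (model_conj \<theta> f) (\<lambda>z. z powi n)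
    = cnj (l2_inner circle_measure f (\<lambda>z. \<theta> z * z powi (- n - 1)))"
  unfolding l2_inner_commute[of _ _ f, symmetric]
proof (rule l2_inner_circle_cong)
  fix z :: complex assume z: "cmod z = 1"
  have "cnj z * cnj (z powi n) = z powi (- n - 1)"
    using cnj_powi_circle[OF z, of 1] cnj_powi_circle[OF z, of n] powi_add_circle[OF z, of "- n" "-1"]
    by (simp add: mult.commute)
  then show "model_conj \<theta> f z * cnj (z powi n) = \<theta> z * z powi (- n - 1) * cnj (f z)"
    by (simp add: model_conj_def mult_ac)
qed

lemma H2_model_conj:
  assumes \<theta>: "inner_fun \<theta>" and f: "sq_integrable circle_measure f"
    and orth: "\<And>m. l2_inner circle_measure f (\<lambda>z. \<theta> z * z powi int m) = 0"
  shows "H2 (model_conj \<theta> f)"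
  unfolding H2_iff
proof (intro conjI allI impI)
  fix n :: int assume "n < 0"
  then have "- n - 1 = int (nat (- n - 1))" by simp
  then show "l2_inner circle_measure (model_conj \<theta> f) (\<lambda>z. z powi n) = 0"
    unfolding l2_inner_model_conj_powi using orth by (metis complex_cnj_zero)
qed (rule sq_integrable_model_conj[OF \<theta> f])

lemma H2_powi: "H2 (\<lambda>z. z powi int m)"
  by (simp add: H2_iff sq_integrable_powi l2_inner_powi)

text \<open>Orthogonality of f to the \<open>\<theta> * z ^ m\<close> yields analyticity of the
  conjugate. Analyticity of f yields its orthogonality to \<theta> H2: after cancelling \<theta>,
  the inner product is the conjugate of the mean of \<open>z * f * g\<close>.\<close>

lemma model_conj_in_model_space:
  assumes \<theta>: "inner_fun \<theta>" and f: "H2 f"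
    and orth: "\<And>m. l2_inner circle_measure f (\<lambda>z. \<theta> z * z powi int m) = 0"
  shows "model_conj \<theta> f \<in> model_space \<theta>"
  unfolding model_space_def
proof (intro CollectI conjI allI impI)
  have f': "sq_integrable circle_measure f" using f by (simp add: H2_iff)
  show "H2 (model_conj \<theta> f)" by (rule H2_model_conj[OF \<theta> f' orth])
  fix g assume g: "H2 g"
  have "ip (model_conj \<theta> f) (\<lambda>z. \<theta> z * g z) = l2_inner circle_measure (\<lambda>z. cnj z * cnj (f z)) g"
    unfolding ip_eq model_conj_def[abs_def]
    using g by (intro l2_inner_inner_mult \<theta> sq_integrable_cnj_mult f') (simp add: H2_iff)
  also have "\<dots> = cnj (l2_inner circle_measure f (\<lambda>z. cnj (z * g z)))"
    unfolding l2_inner_commute[of _ _ f, symmetric] by (rule l2_inner_circle_cong) (simp add: mult_ac)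
  also have "\<dots> = 0" using H2_mult_mean_zero[OF f g] by simp
  finally show "ip (model_conj \<theta> f) (\<lambda>z. \<theta> z * g z) = 0" .
qed

text \<open>Splits the Parseval sum of a system into which two families have been
  interleaved.\<close>

lemma suminf_even_odd:
  fixes a :: "nat \<Rightarrow> ennreal"
  shows "(\<Sum>i. a i) = (\<Sum>n. a (2 * n)) + (\<Sum>n. a (2 * n + 1))"
proof -
  have "a sums (\<Sum>i. a i)" by (simp add: summableI summable_sums)
  then have "(\<lambda>N. \<Sum>i<N * 2. a i) \<longlonglongrightarrow> (\<Sum>i. a i)"
    unfolding sums_def by (rule LIMSEQ_subseq_LIMSEQ[unfolded o_def, where f = "\<lambda>N. N * 2"]) (simp add: strict_mono_def)
  moreover have "(\<Sum>i<N * 2. a i) = (\<Sum>n<N. a (2 * n) + a (2 * n + 1))" for N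
    by (induction N) (simp_all add: add_ac mult.commute)
  ultimately have "(\<lambda>n. a (2 * n) + a (2 * n + 1)) sums (\<Sum>i. a i)" by (simp add: sums_def)
  then have "(\<Sum>i. a i) = (\<Sum>n. a (2 * n) + a (2 * n + 1))" by (simp add: sums_unique)
  also have "\<dots> = (\<Sum>n. a (2 * n)) + (\<Sum>n. a (2 * n + 1))"
    by (rule suminf_add[symmetric]) (rule summableI)+
  finally show ?thesis .
qed

theorem H2_decomposition:
  assumes \<theta>: "inner_fun \<theta>" and onb: "is_onb (model_space \<theta>) I g" and G: "H2 G"
  shows "ennreal (l2_sq circle_measure G)
    = (\<Sum>m. ennreal ((cmod (l2_inner circle_measure G (\<lambda>z. \<theta> z * z powi int m)))\<^sup>2))
    + (\<Sum>n. if n \<in> I then ennreal ((cmod (l2_inner circle_measure G (model_conj \<theta> (g n))))\<^sup>2) else 0)"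
proof -
  let ?C = circle_measure
  let ?U = "(\<lambda>n::int. \<lambda>z::complex. z powi n) ` {..<0}"
  \<comment> \<open>Even indices carry the powers multiplied by \<theta>, odd ones the conjugates of
    the \<open>g n\<close>; odd positions whose half lies outside \<open>I\<close> are left out,
    which accommodates a finite basis.\<close>
  define J where "J = {i. odd i \<longrightarrow> i div 2 \<in> I}"
  define e where "e i = (if even i then \<lambda>z. \<theta> z * z powi int (i div 2) else model_conj \<theta> (g (i div 2)))" for i
  have G': "sq_integrable ?C G" using G by (simp add: H2_iff)
  have g_H2: "H2 (g n)" and g_orth: "\<And>u. H2 u \<Longrightarrow> l2_inner ?C (g n) (\<lambda>z. \<theta> z * u z) = 0" if "n \<in> I" for n
    using onb that by (auto simp: is_onb_def model_space_def ip_eq)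
  have g_sq: "sq_integrable ?C (g n)" if "n \<in> I" for n using g_H2[OF that] by (simp add: H2_iff)
  have g_on: "l2_inner ?C (g n) (g m) = (if n = m then 1 else 0)" if "n \<in> I" "m \<in> I" for n m
    using onb that by (simp add: is_onb_def ip_eq)
  have conj_H2: "H2 (model_conj \<theta> (g n))" if "n \<in> I" for n
    by (rule H2_model_conj[OF \<theta> g_sq[OF that] g_orth[OF that H2_powi]])
  have e_H2: "H2 (e i)" if "i \<in> J" for i
    using that by (auto simp: e_def J_def H2_inner_powi[OF \<theta>] conj_H2)
  have pp: "l2_inner ?C (\<lambda>z. \<theta> z * z powi int m) (\<lambda>z. \<theta> z * z powi int l) = (if m = l then 1 else 0)" for m l
    by (simp add: l2_inner_inner_mult[OF \<theta>] sq_integrable_powi l2_inner_powi)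
  have cp: "l2_inner ?C (model_conj \<theta> (g n)) (\<lambda>z. \<theta> z * z powi int m) = 0" if n: "n \<in> I" for n m
  proof -
    have "l2_inner ?C (model_conj \<theta> (g n)) (\<lambda>z. \<theta> z * z powi int m)
        = l2_inner ?C (\<lambda>z. cnj z * cnj (g n z)) (\<lambda>z. z powi int m)"
      unfolding model_conj_def[abs_def]
      by (intro l2_inner_inner_mult \<theta> sq_integrable_cnj_mult g_sq n sq_integrable_powi)
    also have "\<dots> = cnj (l2_inner ?C (g n) (\<lambda>z. cnj (z * z powi int m)))"
      unfolding l2_inner_commute[of _ _ "g n", symmetric]
      by (rule l2_inner_circle_cong) (simp add: mult_ac)
    also have "\<dots> = 0" using H2_mult_mean_zero[OF g_H2[OF n] H2_powi] by simp
    finally show ?thesis .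
  qed
  have pc: "l2_inner ?C (\<lambda>z. \<theta> z * z powi int m) (model_conj \<theta> (g n)) = 0" if "n \<in> I" for n m
    using cp[OF that] by (subst l2_inner_commute) simp
  have cc: "l2_inner ?C (model_conj \<theta> (g n)) (model_conj \<theta> (g m)) = (if n = m then 1 else 0)"
    if "n \<in> I" "m \<in> I" for n m
    using that by (simp add: l2_inner_model_conj_conj[OF \<theta>] g_sq g_on)
  have half: "i div 2 = j div 2 \<longleftrightarrow> i = j" if "even i \<longleftrightarrow> even j" for i j :: nat
    using that by presburger
  have on: "orthonormal_system ?C J e"
    unfolding orthonormal_system_def
  proof (intro conjI ballI)
    show "sq_integrable ?C (e i)" if "i \<in> J" for i using e_H2[OF that] by (simp add: H2_iff)
    fix i j assume ij: "i \<in> J" "j \<in> J"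
    show "l2_inner ?C (e i) (e j) = (if i = j then 1 else 0)"
    proof (cases "even i"; cases "even j")
      assume "even i" "even j"
      then show ?thesis using half[of i j] by (simp add: e_def pp)
    next
      assume "even i" "odd j"
      then show ?thesis using ij by (auto simp: e_def pc J_def)
    next
      assume "odd i" "even j"
      then show ?thesis using ij by (auto simp: e_def cp J_def)
    next
      assume "odd i" "odd j"
      then show ?thesis using ij half[of i j] by (simp add: e_def cc J_def)
    qed
  qed
  \<comment> \<open>The conjugate of \<open>f\<close> lies in the model space and is orthogonal to
    every \<open>g n\<close>, so it vanishes almost everywhere by the basis property.\<close>
  have complete: "AE z in ?C. f z = 0"
    if f: "sq_integrable ?C f" "\<And>u. u \<in> ?U \<Longrightarrow> l2_inner ?C f u = 0"
      "\<And>i. i \<in> J \<Longrightarrow> l2_inner ?C f (e i) = 0" for f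
  proof -
    have "H2 f" using f(1,2) by (auto simp: H2_iff)
    moreover have orth: "l2_inner ?C f (\<lambda>z. \<theta> z * z powi int m) = 0" for m
      using f(3)[of "2 * m"] by (simp add: J_def e_def)
    ultimately have K: "model_conj \<theta> f \<in> model_space \<theta>" by (rule model_conj_in_model_space[OF \<theta>])
    have "ip (model_conj \<theta> f) (g n) = 0" if "n \<in> I" for n
    proof -
      have "l2_inner ?C f (model_conj \<theta> (g n)) = 0"
        using f(3)[of "2 * n + 1"] that by (simp add: J_def e_def)
      then show ?thesis
        unfolding ip_eq by (subst l2_inner_model_conj_swap, subst l2_inner_commute) simp
    qed
    with onb K have ae: "AE t in lborel. t \<in> {0..2*pi} \<longrightarrow> model_conj \<theta> f (cis t) = 0"
      by (simp add: is_onb_def)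
    have [measurable]: "model_conj \<theta> f \<in> borel_measurable ?C"
      using sq_integrable_model_conj[OF \<theta> f(1)] by (rule sq_integrable_measurable)
    have "{z \<in> space ?C. model_conj \<theta> f z = 0} \<in> sets ?C" by measurable
    with ae have "AE z in ?C. model_conj \<theta> f z = 0" by (subst AE_circle_iff) auto
    moreover have "AE z in ?C. z \<in> space ?C" by (rule AE_space)
    ultimately show ?thesis
      using inner_fun_circle(2)[OF \<theta>]
    proof eventually_elim
      case (elim z)
      \<comment> \<open>Both factors in front of \<open>cnj (f z)\<close> are unimodular, so
        \<open>f z\<close> itself is zero.\<close>
      then have "\<theta> z \<noteq> 0" "z \<noteq> 0" by auto
      then show ?case using elim(1) by (simp add: model_conj_def)
    qed
  qed
  have U: "\<And>u. u \<in> ?U \<Longrightarrow> sq_integrable ?C u"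
      "\<And>u. u \<in> ?U \<Longrightarrow> l2_inner ?C G u = 0"
      "\<And>u i. u \<in> ?U \<Longrightarrow> i \<in> J \<Longrightarrow> l2_inner ?C (e i) u = 0"
    using G e_H2 by (auto simp: sq_integrable_powi H2_iff)
  let ?a = "\<lambda>i. if i \<in> J then (cmod (l2_inner ?C G (e i)))\<^sup>2 else 0"
  have "?a sums l2_sq ?C G"
    by (rule finite_measure.parseval(2)[OF finite_measure_circle on G', where U = ?U], fact U, fact U, fact U, fact complete)
  then have "ennreal (l2_sq ?C G) = (\<Sum>i. ennreal (?a i))"
    by (subst suminf_ennreal_eq) auto
  also have "\<dots> = (\<Sum>n. ennreal (?a (2 * n))) + (\<Sum>n. ennreal (?a (2 * n + 1)))"
    by (rule suminf_even_odd)
  finally have sum: "ennreal (l2_sq ?C G) = (\<Sum>n. ennreal (?a (2 * n))) + (\<Sum>n. ennreal (?a (2 * n + 1)))" .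
  have even: "ennreal (?a (2 * n)) = ennreal ((cmod (l2_inner ?C G (\<lambda>z. \<theta> z * z powi int n)))\<^sup>2)" for n
    by (simp add: J_def e_def)
  have odd: "ennreal (?a (2 * n + 1))
      = (if n \<in> I then ennreal ((cmod (l2_inner ?C G (model_conj \<theta> (g n))))\<^sup>2) else 0)" for n
    by (simp add: J_def e_def)
  show ?thesis using sum unfolding even odd .
qed

section \<open>Summation by parts with values in [0, \<infinity>]\<close>

lemma suminf_ennreal_swap:
  fixes a :: "nat \<Rightarrow> nat \<Rightarrow> ennreal"
  shows "(\<Sum>i. \<Sum>j. a i j) = (\<Sum>j. \<Sum>i. a i j)"
  using nn_integral_suminf[of a "count_space UNIV"]
  by (simp add: nn_integral_count_space_nat)

text \<open>Both sides add \<open>\<gamma> j * a k\<close> over the triangle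
  \<open>j \<le> k\<close>, once by rows and once by columns.\<close>

lemma abel_summation_ennreal:
  fixes \<gamma> a :: "nat \<Rightarrow> ennreal"
  shows "(\<Sum>k. (\<Sum>j\<le>k. \<gamma> j) * a k) = (\<Sum>j. \<gamma> j * (\<Sum>m. a (m + j)))"
proof -
  have row: "(\<Sum>j\<le>k. \<gamma> j) * a k = (\<Sum>j. if j \<le> k then \<gamma> j * a k else 0)" for k
  proof -
    have "(\<Sum>j. if j \<le> k then \<gamma> j * a k else 0) = (\<Sum>j\<le>k. if j \<le> k then \<gamma> j * a k else 0)"
      by (rule suminf_finite) auto
    then show ?thesis by (simp add: sum_distrib_right)
  qed
  have column: "(\<Sum>k. if j \<le> k then \<gamma> j * a k else 0) = \<gamma> j * (\<Sum>m. a (m + j))" for j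
    by (subst suminf_offset[OF summableI, of _ j]) simp
  show ?thesis
    unfolding row suminf_ennreal_swap[of "\<lambda>k j. if j \<le> k then \<gamma> j * a k else 0"] column ..
qed

text \<open>Stated for an arbitrary \<open>c\<close> because it is applied to the coefficients of F
  and of \<Phi> alike. Monotonicity of w enters through the nonnegativity of \<gamma>, without which
  \<open>ennreal\<close> would truncate the increments.\<close>

lemma wnorm_sq_tails:
  assumes w1: "0 \<le> w 1" and wmono: "\<forall>k\<ge>1. w k \<le> w (Suc k)"
    and \<gamma>: "\<gamma> = (\<lambda>k. if k = 1 then w 1 else w k - w (k - 1))"
  shows "wnorm_sq w c = (\<Sum>j. ennreal (\<gamma> (Suc j)) * (\<Sum>m. ennreal ((cmod (c (Suc (m + j))))\<^sup>2)))"
proof -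
  have \<gamma>_nonneg: "0 \<le> \<gamma> (Suc j)" for j
    using w1 wmono by (auto simp: \<gamma>)
  have "w (Suc k) = (\<Sum>j\<le>k. \<gamma> (Suc j))" for k
    by (induction k) (simp_all add: \<gamma>)
  then have "ennreal (w (Suc k) * (cmod (c (Suc k)))\<^sup>2)
      = (\<Sum>j\<le>k. ennreal (\<gamma> (Suc j))) * ennreal ((cmod (c (Suc k)))\<^sup>2)" for k
    by (simp add: ennreal_mult sum_nonneg \<gamma>_nonneg flip: sum_ennreal)
  then show ?thesis unfolding wnorm_sq_def by (simp add: abel_summation_ennreal)
qed

theorem tail_identity:
  assumes F: "H2 F" and \<theta>: "inner_fun \<theta>" and onb: "is_onb (model_space \<theta>) I g"
  shows "(\<Sum>m. ennreal ((cmod (fourier F (int (Suc (m + j)))))\<^sup>2))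
    = (\<Sum>m. ennreal ((cmod (toeplitz (\<lambda>z. cnj z * cnj (\<theta> z)) F (m + j)))\<^sup>2))
    + (\<Sum>n. if n \<in> I then ennreal ((cmod (toeplitz (\<lambda>z. cnj (\<theta> z)) (\<lambda>z. F z * g n z) j))\<^sup>2) else 0)"
proof -
  let ?C = circle_measure
  \<comment> \<open>The shift is by \<open>Suc j\<close> because the weighted norms start at index
    1.\<close>
  obtain G where G: "H2 G" and coeff: "\<And>k. fourier G (int k) = fourier F (int (k + Suc j))"
    and inner: "\<And>u. H2 u \<Longrightarrow> l2_inner ?C G u = l2_inner ?C F (\<lambda>z. z powi int (Suc j) * u z)"
    using H2_shift[OF F, of "Suc j"] by blast
  have "(\<Sum>m. ennreal ((cmod (fourier G (int m)))\<^sup>2)) = ennreal (l2_sq ?C G)"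
    by (rule suminf_ennreal_eq[OF _ H2_parseval(2)[OF G]]) simp
  then have "(\<Sum>m. ennreal ((cmod (fourier F (int (Suc (m + j)))))\<^sup>2)) = ennreal (l2_sq ?C G)"
    by (simp only: coeff add_Suc_right)
  also note H2_decomposition[OF \<theta> onb G]
  finally have sum: "(\<Sum>m. ennreal ((cmod (fourier F (int (Suc (m + j)))))\<^sup>2))
    = (\<Sum>m. ennreal ((cmod (l2_inner ?C G (\<lambda>z. \<theta> z * z powi int m)))\<^sup>2))
    + (\<Sum>n. if n \<in> I then ennreal ((cmod (l2_inner ?C G (model_conj \<theta> (g n))))\<^sup>2) else 0)" .
  \<comment> \<open>One of the \<open>Suc j\<close> conjugated factors z becomes the
    \<open>cnj z\<close> in the Toeplitz symbol; the other \<open>j\<close> join the m from the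
    basis vector.\<close>
  have 1: "l2_inner ?C G (\<lambda>z. \<theta> z * z powi int m) = toeplitz (\<lambda>z. cnj z * cnj (\<theta> z)) F (m + j)" for m
    unfolding inner[OF H2_inner_powi[OF \<theta>]] toeplitz_def Pplus_def fourier_eq
  proof (rule l2_inner_circle_cong)
    fix z :: complex
    have "cnj (z powi int (Suc j)) * cnj (z powi int m) = cnj z * cnj (z powi int (m + j))"
      by (simp only: power_int_of_nat complex_cnj_power) (simp add: power_add mult_ac)
    then show "F z * cnj (z powi int (Suc j) * (\<theta> z * z powi int m))
        = cnj z * cnj (\<theta> z) * F z * cnj (z powi int (m + j))"
      by (simp only: complex_cnj_mult) (simp only: mult_ac)
  qed
  \<comment> \<open>Conjugating \<open>model_conj\<close> releases \<open>g n\<close> unconjugated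
    together with a factor z, which cancels one of the \<open>Suc j\<close> conjugated factors and
    leaves the coefficient of index \<open>j\<close>.\<close>
  have 2: "(if n \<in> I then ennreal ((cmod (l2_inner ?C G (model_conj \<theta> (g n))))\<^sup>2) else 0)
      = (if n \<in> I then ennreal ((cmod (toeplitz (\<lambda>z. cnj (\<theta> z)) (\<lambda>z. F z * g n z) j))\<^sup>2) else 0)" for n
  proof (cases "n \<in> I")
    case True
    then have gn: "H2 (g n)" "\<And>u. H2 u \<Longrightarrow> l2_inner ?C (g n) (\<lambda>z. \<theta> z * u z) = 0"
      using onb by (auto simp: is_onb_def model_space_def ip_eq)
    then have H: "H2 (model_conj \<theta> (g n))"
      by (intro H2_model_conj[OF \<theta>] gn(2) H2_powi) (simp add: H2_iff)
    have "l2_inner ?C G (model_conj \<theta> (g n)) = toeplitz (\<lambda>z. cnj (\<theta> z)) (\<lambda>z. F z * g n z) j"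
      unfolding inner[OF H] toeplitz_def Pplus_def fourier_eq
    proof (rule l2_inner_circle_cong)
      fix z :: complex assume "cmod z = 1"
      then have "z * cnj z = 1" by (simp flip: complex_norm_square)
      moreover have "cnj (z powi int (Suc j)) * z = (z * cnj z) * cnj (z powi int j)"
        by (simp only: power_int_of_nat complex_cnj_power complex_cnj_mult power_Suc mult_ac)
      ultimately have eq: "cnj (z powi int (Suc j)) * z = cnj (z powi int j)" by simp
      have "F z * cnj (z powi int (Suc j) * model_conj \<theta> (g n) z)
          = cnj (\<theta> z) * (F z * g n z) * (cnj (z powi int (Suc j)) * z)"
        by (simp only: model_conj_def complex_cnj_mult complex_cnj_cnj mult_ac)
      then show "F z * cnj (z powi int (Suc j) * model_conj \<theta> (g n) z)
          = cnj (\<theta> z) * (F z * g n z) * cnj (z powi int j)"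
        unfolding eq .
    qed
    then show ?thesis by simp
  qed simp
  show ?thesis using sum unfolding 1 2 .
qed

theorem theorem3p1:
  fixes w :: "nat \<Rightarrow> real" and F \<theta> :: "complex \<Rightarrow> complex"
    and I :: "nat set" and g :: "nat \<Rightarrow> complex \<Rightarrow> complex"
  assumes w1: "0 \<le> w 1"
    and wmono: "\<forall>k\<ge>1. w k \<le> w (Suc k)"
    and F: "H2 F"
    and \<theta>: "inner_fun \<theta>"
    and onb: "is_onb (model_space \<theta>) I g"
  defines "\<gamma> \<equiv> (\<lambda>k. if k = 1 then w 1 else w k - w (k - 1))"
    and "\<Phi> \<equiv> mul_z (toeplitz (\<lambda>z. cnj z * cnj (\<theta> z)) F)"
    and "h \<equiv> (\<lambda>n. mul_z (toeplitz (\<lambda>z. cnj (\<theta> z)) (\<lambda>z. F z * g n z)))"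
  shows "wnorm_sq w (Pplus F) = wnorm_sq w \<Phi> + (\<Sum>n. if n \<in> I then wnorm_sq \<gamma> (h n) else 0)"
proof -
  have \<gamma>: "\<gamma> = (\<lambda>k. if k = 1 then w 1 else w k - w (k - 1))" by (simp add: \<gamma>_def)
  have \<gamma>_nonneg: "0 \<le> \<gamma> (Suc j)" for j
    using w1 wmono by (auto simp: \<gamma>)
  note tails = wnorm_sq_tails[OF w1 wmono \<gamma>]
  define b where "b n j = (if n \<in> I then ennreal ((cmod (h n (Suc j)))\<^sup>2) else 0)" for n j
  have "wnorm_sq w (Pplus F) = (\<Sum>j. ennreal (\<gamma> (Suc j)) * (\<Sum>m. ennreal ((cmod (fourier F (int (Suc (m + j)))))\<^sup>2)))"
    unfolding tails Pplus_def ..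
  \<comment> \<open>The factor z in \<open>mul_z\<close> accounts for the offset between Toeplitz
    coefficient \<open>m + j\<close> and coefficient \<open>Suc (m + j)\<close> of \<Phi>.\<close>
  also have "\<dots> = (\<Sum>j. ennreal (\<gamma> (Suc j)) *
      ((\<Sum>m. ennreal ((cmod (\<Phi> (Suc (m + j))))\<^sup>2)) + (\<Sum>n. b n j)))"
    unfolding tail_identity[OF F \<theta> onb] by (simp add: \<Phi>_def h_def b_def mul_z_def cong: if_cong)
  also have "\<dots> = (\<Sum>j. ennreal (\<gamma> (Suc j)) * (\<Sum>m. ennreal ((cmod (\<Phi> (Suc (m + j))))\<^sup>2))
      + (\<Sum>n. ennreal (\<gamma> (Suc j)) * b n j))"
    by (simp add: distrib_left)
  also have "\<dots> = (\<Sum>j. ennreal (\<gamma> (Suc j)) * (\<Sum>m. ennreal ((cmod (\<Phi> (Suc (m + j))))\<^sup>2)))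
      + (\<Sum>j. \<Sum>n. ennreal (\<gamma> (Suc j)) * b n j)"
    by (rule suminf_add[symmetric]) (rule summableI)+
  also have "(\<Sum>j. \<Sum>n. ennreal (\<gamma> (Suc j)) * b n j) = (\<Sum>n. \<Sum>j. ennreal (\<gamma> (Suc j)) * b n j)"
    by (rule suminf_ennreal_swap)
  also have "\<dots> = (\<Sum>n. if n \<in> I then wnorm_sq \<gamma> (h n) else 0)"
  proof (rule suminf_cong)
    show "(\<Sum>j. ennreal (\<gamma> (Suc j)) * b n j) = (if n \<in> I then wnorm_sq \<gamma> (h n) else 0)" for n
      by (auto simp: b_def wnorm_sq_def ennreal_mult \<gamma>_nonneg simp del: ennreal_suminf_cmult)
  qed
  finally show ?thesis unfolding tails .
qed

end
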